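(* Let $\mathcal{X}$ and $\mathcal{Y}$ be Hilbert spaces and let $U$ on $\mathcal{X}$ and $V$ on $\mathcal{Y}$ be operators with closed range. Then the following are equivalent: (i) $U$ and $V$ are Schur coupled; (ii) $U$ and $V$ are equivalent after extension; (iii) there exist invertible operators $K:\ker U\to\ker V$ and $K_*:\ker U^*\to\ker V^*$.
   Context: "Operator" means bounded linear operator; an operator "on $\mathcal{X}$" maps $\mathcal{X}$ into $\mathcal{X}$; an operator is invertible if it is bijective with bounded inverse. $\dotplus$ denotes the direct sum of Banach spaces. Let $U$ on $\mathcal{X}$ and $V$ on $\mathcal{Y}$ be Banach space operators (in particular, these notions apply to Hilbert space operators). (Schur coupling) $U$ and $V$ are Schur coupled if there exists an operator matrix $S=\begin{bmatrix}A&B\\C&D\end{bmatrix}$ on $\mathcal{X}\dotplus\mathcal{Y}$ with $A$ and $D$ invertible, $U=A-BD^{-1}C$ and $V=D-CA^{-1}B$. (Equivalence after extension) $U$ and $V$ are equivalent after extension if there exist Banach spaces $\mathcal{X}_0$ and $\mathcal{Y}_0$ and invertible operators $E:\mathcal{Y}\dotplus\mathcal{Y}_0\to\mathcal{X}\dotplus\mathcal{X}_0$ and $F:\mathcal{X}\dotplus\mathcal{X}_0\to\mathcal{Y}\dotplus\mathcal{Y}_0$ such that $\begin{bmatrix}U&0\\0&I_{\mathcal{X}_0}\end{bmatrix}=E\begin{bmatrix}V&0\\0&I_{\mathcal{Y}_0}\end{bmatrix}F$. *)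

theory Defs
  imports "HOL-Analysis.Analysis"
begin

text \<open>
  The scalar field is \<open>\<real>\<close> or \<open>\<complex>\<close>; the two cases are treated
  simultaneously. An element fixed by the conjugation satisfies
  \<open>x * x = of_real ((norm x)\<^sup>2)\<close> and is hence real, so a field of this class is \<open>\<real>\<close> or a
  quadratic extension of it; see \<open>real_or_complex_cases\<close>.
\<close>

class real_or_complex = real_normed_field +
  fixes cjg :: "'a \<Rightarrow> 'a"
  assumes cjg_add: "cjg (x + y) = cjg x + cjg y"
    and cjg_mult: "cjg (x * y) = cjg x * cjg y"
    and cjg_cjg: "cjg (cjg x) = x"
    and mult_cjg_scaleR: "x * cjg x = (norm x)\<^sup>2 *\<^sub>R 1"

lemma mult_cjg: "x * cjg x = of_real ((norm x)\<^sup>2)" for x :: "'a::real_or_complex"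
  by (simp add: mult_cjg_scaleR of_real_def)

instantiation real :: real_or_complex
begin
definition cjg_real :: "real \<Rightarrow> real" where "cjg_real x = x"
instance by standard (auto simp: cjg_real_def power2_eq_square)
end

instantiation complex :: real_or_complex
begin
definition cjg_complex :: "complex \<Rightarrow> complex" where "cjg_complex = cnj"
instance by standard (auto simp: cjg_complex_def scaleR_conv_of_real simp flip: complex_norm_square)
end

lemma cjg_fixed_real:
  fixes x :: "'k::real_or_complex"
  assumes "cjg x = x"
  shows "x \<in> \<real>"
proof -
  have "x\<^sup>2 = (of_real (norm x))\<^sup>2"
    using mult_cjg[of x] assms by (simp add: power2_eq_square)
  then have "x = of_real (norm x) \<or> x = - of_real (norm x)"
    by (simp add: power2_eq_iff)
  then show ?thesis
    by (metis Reals_minus Reals_of_real)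
qed

lemma real_or_complex_cases:
  "(UNIV :: 'k::real_or_complex set) = \<real> \<or>
   (\<exists>i::'k. i * i = -1 \<and> cjg i = - i \<and> (\<forall>x. \<exists>a b. x = of_real a + of_real b * i))"
proof (cases "(UNIV :: 'k set) = \<real>")
  case False
  then obtain x :: 'k where x: "x \<notin> \<real>" by auto
  have cjg0: "cjg (0::'k) = 0"
    using cjg_add[of 0 "0::'k"] by simp
  have cjg_minus: "cjg (- z) = - cjg z" for z :: 'k
    using cjg_add[of z "- z"] cjg0 by (simp add: eq_neg_iff_add_eq_0 add.commute)
  have sum_real: "z + cjg z \<in> \<real>" for z :: 'k
    by (rule cjg_fixed_real) (simp add: cjg_add cjg_cjg add.commute)
  define d where "d = x - cjg x"
  have d_cjg: "cjg d = - d"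
    using cjg_add[of x "- cjg x"] by (simp add: d_def cjg_minus cjg_cjg)
  have "d \<noteq> 0"
    using x cjg_fixed_real[of x] by (auto simp: d_def)
  have dd: "d * d = - of_real ((norm d)\<^sup>2)"
    using mult_cjg[of d] d_cjg by (metis minus_minus mult_minus_right)
  have cjg_real: "cjg (of_real r) = (of_real r :: 'k)" for r
  proof (cases "r = 0")
    case False
    have "of_real r * cjg (of_real r) = (of_real r * of_real r :: 'k)"
      using mult_cjg[of "of_real r :: 'k"] by (simp add: power2_eq_square flip: of_real_mult)
    with False show ?thesis by simp
  qed (simp add: cjg0)
  define i where "i = of_real (inverse (norm d)) * d"
  have ii: "i * i = -1"
  proof -
    have "i * i = of_real ((inverse (norm d))\<^sup>2) * (d * d)"
      by (simp add: i_def power2_eq_square)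
    also have "\<dots> = - of_real ((inverse (norm d))\<^sup>2 * (norm d)\<^sup>2)"
      by (simp add: dd)
    also have "(inverse (norm d))\<^sup>2 * (norm d)\<^sup>2 = 1"
      using \<open>d \<noteq> 0\<close> by (simp add: power_inverse)
    finally show ?thesis by simp
  qed
  have ci: "cjg i = - i"
    by (simp add: i_def cjg_mult cjg_real d_cjg del: of_real_inverse)
  have "\<exists>a b. z = of_real a + of_real b * i" for z
  proof -
    obtain a where a: "z + cjg z = of_real a"
      using sum_real[of z] by (auto elim: Reals_cases)
    have "cjg (i * (z - cjg z)) = i * (z - cjg z)"
    proof -
      have "cjg (z - cjg z) = - (z - cjg z)"
        using cjg_add[of z "- cjg z"] by (simp add: cjg_minus cjg_cjg)
      then show ?thesis by (simp only: cjg_mult ci minus_mult_minus)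
    qed
    then obtain b where b: "i * (z - cjg z) = of_real b"
      using cjg_fixed_real by (auto elim: Reals_cases)
    have "i * (i * (z - cjg z)) = - (z - cjg z)"
      by (simp add: ii flip: mult.assoc)
    then have c: "z - cjg z = - (of_real b * i)"
      using b by (simp add: mult.commute)
    have "2 * z = of_real a + of_real (- b) * i"
    proof -
      have "2 * z = (z + cjg z) + (z - cjg z)" by simp
      then show ?thesis unfolding a c by simp
    qed
    then have "z = (of_real a + of_real (- b) * i) / 2"
      by (metis nonzero_mult_div_cancel_left zero_neq_numeral)
    then have "z = of_real (a / 2) + of_real (- b / 2) * i"
      by (simp add: add_divide_distrib diff_divide_distrib)
    then show ?thesis by blast
  qed
  with ii ci show ?thesis by blast
qed simp

text \<open>
  Completeness and the topology come from class \<open>banach\<close>. The scalar multiplication is a parameter, since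
  the class only provides the real one.
\<close>

locale banach_space = vector_space scale
  for scale :: "'k::real_or_complex \<Rightarrow> 'a::banach \<Rightarrow> 'a" +
  assumes norm_scale: "norm (scale c x) = norm c * norm x"
    and scale_of_real: "scale (of_real r) x = r *\<^sub>R x"

locale hilbert_space = banach_space scale
  for scale :: "'k::real_or_complex \<Rightarrow> 'a::banach \<Rightarrow> 'a" +
  fixes ip :: "'a \<Rightarrow> 'a \<Rightarrow> 'k"
  assumes ip_add_left: "ip (x + y) z = ip x z + ip y z"
    and ip_scale_left: "ip (scale c x) y = c * ip x y"
    and ip_commute: "ip y x = cjg (ip x y)"
    and ip_self: "ip x x = of_real ((norm x)\<^sup>2)"

lemma hilbert_space_scaleR_inner:
  "hilbert_space scaleR (inner :: 'a::{real_inner,banach} \<Rightarrow> 'a \<Rightarrow> real)"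
  by unfold_locales
    (auto simp: algebra_simps inner_commute cjg_real_def power2_norm_eq_inner)

lemma hilbert_space_complex: "hilbert_space (*) (\<lambda>x y::complex. x * cnj y)"
  by unfold_locales
    (auto simp: algebra_simps norm_mult cjg_complex_def scaleR_conv_of_real complex_norm_square
      simp flip: of_real_power)

definition prod_scale ::
    "('k \<Rightarrow> 'a \<Rightarrow> 'a) \<Rightarrow> ('k \<Rightarrow> 'b \<Rightarrow> 'b) \<Rightarrow> 'k \<Rightarrow> 'a \<times> 'b \<Rightarrow> 'a \<times> 'b" where
  "prod_scale sX sY c = map_prod (sX c) (sY c)"

lemma banach_space_prod_scale:
  assumes "banach_space sX" "banach_space sY"
  shows "banach_space (prod_scale sX sY)"
proof -
  interpret X: banach_space sX by fact
  interpret Y: banach_space sY by fact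
  show ?thesis
  proof
    fix c :: 'a and x :: "'b \<times> 'c"
    have "(norm c * norm (fst x))\<^sup>2 + (norm c * norm (snd x))\<^sup>2
      = (norm c)\<^sup>2 * ((norm (fst x))\<^sup>2 + (norm (snd x))\<^sup>2)"
      by (simp add: power_mult_distrib algebra_simps)
    then show "norm (prod_scale sX sY c x) = norm c * norm x"
      by (simp add: prod_scale_def norm_prod_def map_prod_def split_beta
          X.norm_scale Y.norm_scale real_sqrt_mult)
  qed (auto simp: prod_scale_def prod_eq_iff X.scale_of_real Y.scale_of_real
      X.scale_right_distrib Y.scale_right_distrib X.scale_left_distrib Y.scale_left_distrib)
qed

text \<open>
  Operators between linear subspaces \<open>S\<close> and \<open>T\<close> of Banach spaces; the values outside of \<open>S\<close> are
  irrelevant.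
\<close>

definition is_operator ::
    "('k \<Rightarrow> 'a::real_normed_vector \<Rightarrow> 'a) \<Rightarrow> ('k \<Rightarrow> 'b::real_normed_vector \<Rightarrow> 'b) \<Rightarrow>
     'a set \<Rightarrow> 'b set \<Rightarrow> ('a \<Rightarrow> 'b) \<Rightarrow> bool" where
  "is_operator sX sY S T f \<longleftrightarrow>
     f ` S \<subseteq> T \<and>
     (\<forall>x\<in>S. \<forall>y\<in>S. f (x + y) = f x + f y) \<and>
     (\<forall>c. \<forall>x\<in>S. f (sX c x) = sY c (f x)) \<and>
     (\<exists>M. \<forall>x\<in>S. norm (f x) \<le> M * norm x)"

definition invertible_operator ::
    "('k \<Rightarrow> 'a::real_normed_vector \<Rightarrow> 'a) \<Rightarrow> ('k \<Rightarrow> 'b::real_normed_vector \<Rightarrow> 'b) \<Rightarrow>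
     'a set \<Rightarrow> 'b set \<Rightarrow> ('a \<Rightarrow> 'b) \<Rightarrow> bool" where
  "invertible_operator sX sY S T f \<longleftrightarrow>
     is_operator sX sY S T f \<and> bij_betw f S T \<and> is_operator sY sX T S (inv_into S f)"

definition ker :: "('a \<Rightarrow> 'b::zero) \<Rightarrow> 'a set" where
  "ker f = {x. f x = 0}"

text \<open>For bounded \<open>f\<close> on Hilbert spaces the adjoint exists and is unique.\<close>

definition hilbert_adjoint ::
    "('a \<Rightarrow> 'a \<Rightarrow> 'k) \<Rightarrow> ('b \<Rightarrow> 'b \<Rightarrow> 'k) \<Rightarrow> ('a \<Rightarrow> 'b) \<Rightarrow> 'b \<Rightarrow> 'a" where
  "hilbert_adjoint ipX ipY f = (THE g. \<forall>x y. ipY (f x) y = ipX x (g y))"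

definition schur_coupled ::
    "('k \<Rightarrow> 'a::real_normed_vector \<Rightarrow> 'a) \<Rightarrow> ('k \<Rightarrow> 'b::real_normed_vector \<Rightarrow> 'b) \<Rightarrow>
     ('a \<Rightarrow> 'a) \<Rightarrow> ('b \<Rightarrow> 'b) \<Rightarrow> bool" where
  "schur_coupled sX sY U V \<longleftrightarrow>
     (\<exists>A B C D.
        is_operator sX sX UNIV UNIV A \<and> is_operator sY sX UNIV UNIV B \<and>
        is_operator sX sY UNIV UNIV C \<and> is_operator sY sY UNIV UNIV D \<and>
        invertible_operator sX sX UNIV UNIV A \<and> invertible_operator sY sY UNIV UNIV D \<and>
        U = (\<lambda>x. A x - B (inv D (C x))) \<and>
        V = (\<lambda>y. D y - C (inv A (B y))))"

text \<open>
  HOL cannot quantify existentially over types, so the Banach spaces \<open>X\<^sub>0\<close> and \<open>Y\<^sub>0\<close> range over the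
  closed subspaces of an ambient Banach space \<open>W\<close>. The definition captures the usual notion when
  \<open>W = X \<times> Y \<times> Z\<close> with \<open>Z\<close> an arbitrary Banach space: any two
  Banach spaces \<open>X\<^sub>0\<close> and \<open>Y\<^sub>0\<close> occur, up to isometric isomorphism, as closed subspaces of such a \<open>W\<close>
  (take \<open>Z = X\<^sub>0 \<times> Y\<^sub>0\<close>; see \<open>equivalent_after_extensionI\<close>), and the factors \<open>X\<close> and \<open>Y\<close> guarantee
  that \<open>W\<close> is large enough whatever \<open>Z\<close> is.
\<close>

definition equivalent_after_extension ::
    "('k::field \<Rightarrow> 'a::real_normed_vector \<Rightarrow> 'a) \<Rightarrow> ('k \<Rightarrow> 'b::real_normed_vector \<Rightarrow> 'b) \<Rightarrow>
     ('k \<Rightarrow> 'w::real_normed_vector \<Rightarrow> 'w) \<Rightarrow> ('a \<Rightarrow> 'a) \<Rightarrow> ('b \<Rightarrow> 'b) \<Rightarrow> bool" where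
  "equivalent_after_extension sX sY sW U V \<longleftrightarrow>
     (\<exists>X\<^sub>0 Y\<^sub>0 E F.
        module.subspace sW X\<^sub>0 \<and> closed X\<^sub>0 \<and> module.subspace sW Y\<^sub>0 \<and> closed Y\<^sub>0 \<and>
        invertible_operator (prod_scale sY sW) (prod_scale sX sW) (UNIV \<times> Y\<^sub>0) (UNIV \<times> X\<^sub>0) E \<and>
        invertible_operator (prod_scale sX sW) (prod_scale sY sW) (UNIV \<times> X\<^sub>0) (UNIV \<times> Y\<^sub>0) F \<and>
        (\<forall>p \<in> UNIV \<times> X\<^sub>0. map_prod U id p = E (map_prod V id (F p))))"

lemma invertible_operatorI:
  assumes f: "is_operator sX sY S T f" and g: "is_operator sY sX T S g"
    and gf: "\<And>x. x \<in> S \<Longrightarrow> g (f x) = x" and fg: "\<And>y. y \<in> T \<Longrightarrow> f (g y) = y"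
    and T: "\<And>x y. x \<in> T \<Longrightarrow> y \<in> T \<Longrightarrow> x + y \<in> T" "\<And>c x. x \<in> T \<Longrightarrow> sY c x \<in> T"
  shows "invertible_operator sX sY S T f"
proof -
  have bij: "bij_betw f S T"
    by (rule bij_betwI[where g = g]) (use f g gf fg in \<open>auto simp: is_operator_def\<close>)
  have "inv_into S f y = g y" if "y \<in> T" for y
    using that bij g fg gf
    by (metis bij_betw_def image_subset_iff inv_into_f_f is_operator_def)
  then have "is_operator sY sX T S (inv_into S f)"
    using g T by (auto simp: is_operator_def)
  with f bij show ?thesis by (simp add: invertible_operator_def)
qed

lemma transport_operator:
  fixes sX :: "'k \<Rightarrow> 'x::real_normed_vector \<Rightarrow> 'x" and sY :: "'k \<Rightarrow> 'y::real_normed_vector \<Rightarrow> 'y"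
    and jP :: "'p::real_normed_vector \<Rightarrow> 'w::real_normed_vector"
    and jQ :: "'q::real_normed_vector \<Rightarrow> 'w"
  assumes f: "is_operator (prod_scale sX sP) (prod_scale sY sQ) UNIV UNIV f"
    and jP: "\<And>x y. jP (x + y) = jP x + jP y" "\<And>c x. jP (sP c x) = sW c (jP x)"
      "\<And>x. norm (jP x) = norm x" "\<And>x. rP (jP x) = x"
    and jQ: "\<And>x y. jQ (x + y) = jQ x + jQ y" "\<And>c x. jQ (sQ c x) = sW c (jQ x)"
      "\<And>x. norm (jQ x) = norm x"
  shows "is_operator (prod_scale sX sW) (prod_scale sY sW) (UNIV \<times> range jP) (UNIV \<times> range jQ)
    (map_prod id jQ \<circ> f \<circ> map_prod id rP)"
proof -
  obtain M where M: "\<And>x. norm (f x) \<le> M * norm x"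
    using f unfolding is_operator_def by blast
  have add: "f (a + b) = f a + f b" for a b
    using f unfolding is_operator_def by blast
  have sc: "f (prod_scale sX sP c a) = prod_scale sY sQ c (f a)" for a c
    using f unfolding is_operator_def by blast
  have nQ: "norm (map_prod id jQ p) = norm p" for p :: "'y \<times> 'q"
    by (cases p) (simp add: norm_Pair jQ)
  have "norm (map_prod id jQ (f (x, z))) \<le> M * norm (x, jP z)" for x z
    using M[of "(x, z)"] by (simp add: nQ norm_Pair jP)
  moreover have "map_prod id jQ (f (x + x', rP (jP z + jP z')))
      = map_prod id jQ (f (x, z)) + map_prod id jQ (f (x', z'))" for x x' z z'
    using add[of "(x, z)" "(x', z')"]
    by (simp add: jP(4) flip: jP(1)) (simp add: map_prod_def split_beta jQ)
  moreover have "map_prod id jQ (f (sX c x, rP (sW c (jP z))))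
      = prod_scale sY sW c (map_prod id jQ (f (x, z)))" for c x z
    using sc[of c "(x, z)"]
    by (simp add: jP(4) prod_scale_def flip: jP(2)) (simp add: map_prod_def split_beta jQ)
  ultimately show ?thesis
    unfolding is_operator_def
    by (auto simp: jP(4) prod_scale_def map_prod_def split_beta)
qed

lemma transport_invertible:
  fixes sX :: "'k \<Rightarrow> 'x::real_normed_vector \<Rightarrow> 'x" and sY :: "'k \<Rightarrow> 'y::real_normed_vector \<Rightarrow> 'y"
    and jP :: "'p::real_normed_vector \<Rightarrow> 'w::real_normed_vector"
    and jQ :: "'q::real_normed_vector \<Rightarrow> 'w"
  assumes f: "invertible_operator (prod_scale sX sP) (prod_scale sY sQ) UNIV UNIV f"
    and jP: "\<And>x y. jP (x + y) = jP x + jP y" "\<And>c x. jP (sP c x) = sW c (jP x)"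
      "\<And>x. norm (jP x) = norm x" "\<And>x. rP (jP x) = x"
    and jQ: "\<And>x y. jQ (x + y) = jQ x + jQ y" "\<And>c x. jQ (sQ c x) = sW c (jQ x)"
      "\<And>x. norm (jQ x) = norm x" "\<And>x. rQ (jQ x) = x"
  shows "invertible_operator (prod_scale sX sW) (prod_scale sY sW)
    (UNIV \<times> range jP) (UNIV \<times> range jQ) (map_prod id jQ \<circ> f \<circ> map_prod id rP)"
proof (rule invertible_operatorI)
  have op: "is_operator (prod_scale sX sP) (prod_scale sY sQ) UNIV UNIV f"
    and opinv: "is_operator (prod_scale sY sQ) (prod_scale sX sP) UNIV UNIV (inv f)"
    and "bij f"
    using f by (auto simp: invertible_operator_def)
  show "is_operator (prod_scale sX sW) (prod_scale sY sW) (UNIV \<times> range jP) (UNIV \<times> range jQ)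
      (map_prod id jQ \<circ> f \<circ> map_prod id rP)"
    by (rule transport_operator[OF op]) (fact jP jQ)+
  show "is_operator (prod_scale sY sW) (prod_scale sX sW) (UNIV \<times> range jQ) (UNIV \<times> range jP)
      (map_prod id jP \<circ> inv f \<circ> map_prod id rQ)"
    by (rule transport_operator[OF opinv]) (fact jP jQ)+
  have eq: "map_prod id rQ (map_prod id jQ p) = p" "map_prod id rP (map_prod id jP q) = q"
    for p :: "'y \<times> 'q" and q :: "'x \<times> 'p"
    by (simp_all add: map_prod_def split_beta jP jQ)
  show "(map_prod id jP \<circ> inv f \<circ> map_prod id rQ) ((map_prod id jQ \<circ> f \<circ> map_prod id rP) x) = x"
    if "x \<in> UNIV \<times> range jP" for x
    using that \<open>bij f\<close> by (auto simp: eq jP(4) bij_is_inj)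
  show "(map_prod id jQ \<circ> f \<circ> map_prod id rP) ((map_prod id jP \<circ> inv f \<circ> map_prod id rQ) y) = y"
    if "y \<in> UNIV \<times> range jQ" for y
    using that \<open>bij f\<close> by (auto simp: eq jP(4) jQ(4) bij_is_surj surj_f_inv_f)
  show "x + y \<in> UNIV \<times> range jQ" if "x \<in> UNIV \<times> range jQ" "y \<in> UNIV \<times> range jQ" for x y :: "'y \<times> 'w"
    using that by (auto simp flip: jQ(1))
  show "prod_scale sY sW c y \<in> UNIV \<times> range jQ" if "y \<in> UNIV \<times> range jQ" for c y
    using that by (auto simp: prod_scale_def simp flip: jQ(2))
qed

text \<open>
  An equivalence after extension by arbitrary Banach spaces (here: types) \<open>'c\<close> and \<open>'d\<close> is
  covered by the definition.
\<close>

lemma equivalent_after_extensionI: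
  fixes sX :: "'k::real_or_complex \<Rightarrow> 'a::banach \<Rightarrow> 'a" and sY :: "'k \<Rightarrow> 'b::banach \<Rightarrow> 'b"
    and sP :: "'k \<Rightarrow> 'c::banach \<Rightarrow> 'c" and sQ :: "'k \<Rightarrow> 'd::banach \<Rightarrow> 'd"
  defines "sW \<equiv> prod_scale sX (prod_scale sY (prod_scale sP sQ))"
  assumes "banach_space sX" "banach_space sY" "banach_space sP" "banach_space sQ"
    and E: "invertible_operator (prod_scale sY sQ) (prod_scale sX sP) UNIV UNIV E"
    and F: "invertible_operator (prod_scale sX sP) (prod_scale sY sQ) UNIV UNIV F"
    and UV: "map_prod U id = E \<circ> map_prod V id \<circ> F"
  shows "equivalent_after_extension sX sY sW U V"
proof -
  interpret X: banach_space sX by fact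
  interpret Y: banach_space sY by fact
  interpret P: banach_space sP by fact
  interpret Q: banach_space sQ by fact
  interpret W: banach_space sW
    unfolding sW_def by (intro banach_space_prod_scale) fact+
  define jP :: "'c \<Rightarrow> 'a \<times> 'b \<times> 'c \<times> 'd" where "jP z = (0, 0, z, 0)" for z
  define jQ :: "'d \<Rightarrow> 'a \<times> 'b \<times> 'c \<times> 'd" where "jQ z = (0, 0, 0, z)" for z
  define rP :: "'a \<times> 'b \<times> 'c \<times> 'd \<Rightarrow> 'c" where "rP w = fst (snd (snd w))" for w
  define rQ :: "'a \<times> 'b \<times> 'c \<times> 'd \<Rightarrow> 'd" where "rQ w = snd (snd (snd w))" for w
  have jP: "jP (x + y) = jP x + jP y" "jP (sP c x) = sW c (jP x)" "norm (jP x) = norm x"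
    "rP (jP x) = x" for x y c
    by (simp_all add: jP_def rP_def sW_def prod_scale_def norm_Pair)
  have jQ: "jQ (x + y) = jQ x + jQ y" "jQ (sQ c x) = sW c (jQ x)" "norm (jQ x) = norm x"
    "rQ (jQ x) = x" for x y c
    by (simp_all add: jQ_def rQ_def sW_def prod_scale_def norm_Pair)
  have rangeP: "range jP = {0} \<times> {0} \<times> UNIV \<times> {0}" and rangeQ: "range jQ = {0} \<times> {0} \<times> {0} \<times> UNIV"
    by (auto simp: jP_def jQ_def)
  have sub: "W.subspace (range jP)" "W.subspace (range jQ)"
    unfolding W.subspace_def by (auto simp: rangeP rangeQ zero_prod_def sW_def prod_scale_def)
  have cl: "closed (range jP)" "closed (range jQ)"
    by (auto simp: rangeP rangeQ intro!: closed_Times)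
  have E': "invertible_operator (prod_scale sY sW) (prod_scale sX sW)
      (UNIV \<times> range jQ) (UNIV \<times> range jP) (map_prod id jP \<circ> E \<circ> map_prod id rQ)"
    by (rule transport_invertible[OF E]) (fact jP jQ)+
  have F': "invertible_operator (prod_scale sX sW) (prod_scale sY sW)
      (UNIV \<times> range jP) (UNIV \<times> range jQ) (map_prod id jQ \<circ> F \<circ> map_prod id rP)"
    by (rule transport_invertible[OF F]) (fact jP jQ)+
  have eq: "map_prod U id p = (map_prod id jP \<circ> E \<circ> map_prod id rQ)
      (map_prod V id ((map_prod id jQ \<circ> F \<circ> map_prod id rP) p))"
    if p: "p \<in> UNIV \<times> range jP" for p
  proof -
    obtain x z where p: "p = (x, jP z)" using p by auto
    have "map_prod id rQ (map_prod V id (map_prod id jQ q)) = map_prod V id q" for q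
      by (cases q) (simp add: jQ)
    moreover have "E (map_prod V id (F (x, z))) = (U x, z)"
      using fun_cong[OF UV, of "(x, z)"] by simp
    ultimately show ?thesis by (simp add: p jP)
  qed
  show ?thesis
    unfolding equivalent_after_extension_def using sub cl E' F' eq by blast
qed

end

theory Submission
  imports Defs
begin

text \<open>
  From (i) to (ii): if \<open>A\<close> and \<open>D\<close> are invertible, the operator matrix with entries \<open>A\<close>, \<open>B\<close>, \<open>C\<close>,
  \<open>D\<close> factors through \<open>U \<oplus> D\<close> and through \<open>A \<oplus> V\<close> with triangular invertible factors. Equating the two
  factorisations exhibits \<open>U \<oplus> I\<^sub>Y\<close> and \<open>V \<oplus> I\<^sub>X\<close> as equivalent
  (\<open>schur_coupled_imp_equivalent_after_extension\<close>).

  From (ii) to (iii): in \<open>U \<oplus> I = E (V \<oplus> I) F\<close> the operator \<open>F\<close> maps \<open>ker U \<oplus> 0\<close> onto \<open>ker V \<oplus> 0\<close>,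
  and \<open>E\<close> maps the range of \<open>V \<oplus> I\<close> onto that of \<open>U \<oplus> I\<close>, so it induces an isomorphism of the
  quotients, that is, of \<open>Y / ran V\<close> with \<open>X / ran U\<close>. As the ranges are closed, these quotients are
  modelled by \<open>ker V\<^sup>*\<close> and \<open>ker U\<^sup>*\<close>
  (\<open>equivalence_maps_kernel\<close>, \<open>equivalence_maps_cokernel\<close>).

  From (iii) to (i): this is where Hilbert spaces matter. By the open mapping theorem \<open>U\<close> restricts to
  an isomorphism of \<open>(ker U)\<^sup>\<bottom>\<close> onto \<open>ran U = (ker U\<^sup>*)\<^sup>\<bottom>\<close>, and similarly for \<open>V\<close>
  (\<open>closed_range_splitting\<close>). Of two Hilbert spaces, one embeds isometrically into the other
  (\<open>hilbert_spaces_comparable\<close>); by symmetry let \<open>j\<close> embed \<open>(ker U)\<^sup>\<bottom>\<close> into \<open>(ker V)\<^sup>\<bottom>\<close>, with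
  orthogonal complement \<open>Q\<close> of its range. Up to isomorphisms,
  \<open>V\<close> then acts as the identity on \<open>(ker U)\<^sup>\<bottom> \<oplus> Q\<close> and as zero from \<open>ker U\<close> to \<open>ker U\<^sup>*\<close>, hence like
  \<open>U \<oplus> I\<^sub>Q\<close>. Finally, \<open>U\<close> and \<open>U \<oplus> I\<^sub>Q\<close> are Schur coupled because \<open>U = I - R J\<close> and
  \<open>U \<oplus> I\<^sub>Q = I - J R\<close> for the inclusion \<open>J\<close> of \<open>X\<close> into \<open>X \<oplus> Q\<close> and \<open>R (x, q) = x - U x\<close>; invertible
  factors on either side of \<open>U \<oplus> I\<^sub>Q\<close> can be absorbed into the coupling matrix
  (\<open>schur_coupled_if_splittings_match\<close>).
\<close>

section \<open>Bounded operators\<close>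

text \<open>
  Gives access to the theory of \<open>bounded_linear\<close>: real homogeneity is the case of real scalars.
\<close>

lemma is_operator_UNIV_iff:
  fixes sX :: "'k::real_or_complex \<Rightarrow> 'a::banach \<Rightarrow> 'a" and sY :: "'k \<Rightarrow> 'b::banach \<Rightarrow> 'b"
  assumes "banach_space sX" "banach_space sY"
  shows "is_operator sX sY UNIV UNIV f \<longleftrightarrow>
    bounded_linear f \<and> (\<forall>c x. f (sX c x) = sY c (f x))"
proof -
  interpret X: banach_space sX by fact
  interpret Y: banach_space sY by fact
  show ?thesis
  proof safe
    assume f: "is_operator sX sY UNIV UNIV f"
    then obtain M where "\<forall>x. norm (f x) \<le> M * norm x"
      by (auto simp: is_operator_def)
    moreover have "f (r *\<^sub>R x) = r *\<^sub>R f x" for r x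
      using f by (simp add: is_operator_def flip: X.scale_of_real Y.scale_of_real)
    ultimately show "bounded_linear f"
      using f by (intro bounded_linear_intro[where K = M]) (auto simp: is_operator_def mult.commute)
  next
    assume f: "bounded_linear f" and s: "\<forall>c x. f (sX c x) = sY c (f x)"
    interpret f: bounded_linear f by fact
    show "is_operator sX sY UNIV UNIV f"
      using f.bounded s by (auto simp: is_operator_def f.add mult.commute)
  qed (auto simp: is_operator_def)
qed

lemma is_operator_id: "is_operator s s UNIV UNIV (\<lambda>x. x)"
  by (auto simp: is_operator_def intro: exI[of _ 1])

lemma is_operator_comp:
  assumes f: "is_operator sX sY S T f" and g: "is_operator sY sZ T W g"
  shows "is_operator sX sZ S W (\<lambda>x. g (f x))"
proof -
  obtain M where M: "\<And>x. x \<in> S \<Longrightarrow> norm (f x) \<le> M * norm x"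
    using f unfolding is_operator_def by blast
  obtain N where N: "\<And>x. x \<in> T \<Longrightarrow> norm (g x) \<le> N * norm x"
    using g unfolding is_operator_def by blast
  have T: "f x \<in> T" if "x \<in> S" for x
    using f that by (auto simp: is_operator_def)
  have "norm (g (f x)) \<le> (\<bar>N\<bar> * M) * norm x" if "x \<in> S" for x
  proof -
    have "norm (g (f x)) \<le> \<bar>N\<bar> * norm (f x)"
      using N[OF T[OF that]] by (meson abs_ge_self mult_right_mono norm_ge_zero order_trans)
    also have "\<dots> \<le> \<bar>N\<bar> * (M * norm x)"
      using M[OF that] by (intro mult_left_mono) auto
    finally show ?thesis by (simp add: mult.assoc)
  qed
  then show ?thesis
    using f g T unfolding is_operator_def by (auto simp: image_subset_iff)
qed

lemma is_operator_codomain: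
  assumes "is_operator sX sY S T f" and "\<And>x. x \<in> S \<Longrightarrow> f x \<in> T'"
  shows "is_operator sX sY S T' f"
  using assms by (auto simp: is_operator_def)

lemma is_operator_add:
  fixes sX :: "'k::real_or_complex \<Rightarrow> 'a::banach \<Rightarrow> 'a" and sY :: "'k \<Rightarrow> 'b::banach \<Rightarrow> 'b"
  assumes "banach_space sX" "banach_space sY"
    and "is_operator sX sY UNIV UNIV f" "is_operator sX sY UNIV UNIV g"
  shows "is_operator sX sY UNIV UNIV (\<lambda>x. f x + g x)"
proof -
  interpret Y: banach_space sY by fact
  show ?thesis
    using assms(3,4) unfolding is_operator_UNIV_iff[OF assms(1,2)]
    by (auto intro: bounded_linear_add simp: Y.scale_right_distrib)
qed

lemma is_operator_diff:
  fixes sX :: "'k::real_or_complex \<Rightarrow> 'a::banach \<Rightarrow> 'a" and sY :: "'k \<Rightarrow> 'b::banach \<Rightarrow> 'b"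
  assumes "banach_space sX" "banach_space sY"
    and "is_operator sX sY UNIV UNIV f" "is_operator sX sY UNIV UNIV g"
  shows "is_operator sX sY UNIV UNIV (\<lambda>x. f x - g x)"
proof -
  interpret Y: banach_space sY by fact
  show ?thesis
    using assms(3,4) unfolding is_operator_UNIV_iff[OF assms(1,2)]
    by (auto intro: bounded_linear_sub simp: Y.scale_right_diff_distrib)
qed

lemma is_operator_zero_diff:
  fixes f :: "'a::banach \<Rightarrow> 'b::banach"
  assumes f: "is_operator sX sY UNIV UNIV f"
  shows "f 0 = 0" "f (x - y) = f x - f y"
proof -
  have add: "f (x + y) = f x + f y" for x y
    using f by (auto simp: is_operator_def)
  show "f 0 = 0" using add[of 0 0] by simp
  show "f (x - y) = f x - f y" using add[of "x - y" y] by (simp add: algebra_simps)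
qed

lemma is_operator_fst: "is_operator (prod_scale sX sY) sX S UNIV fst"
  by (auto simp: is_operator_def prod_scale_def intro!: exI[of _ 1] norm_fst_le)

lemma is_operator_snd: "is_operator (prod_scale sX sY) sY S UNIV snd"
  by (auto simp: is_operator_def prod_scale_def intro!: exI[of _ 1] norm_snd_le)

lemma is_operator_Pair:
  fixes f :: "'a::banach \<Rightarrow> 'b::banach" and g :: "'a \<Rightarrow> 'c::banach"
  assumes f: "is_operator s sX UNIV UNIV f" and g: "is_operator s sY UNIV UNIV g"
  shows "is_operator s (prod_scale sX sY) UNIV UNIV (\<lambda>x. (f x, g x))"
proof -
  obtain M where M: "\<And>x. norm (f x) \<le> M * norm x"
    using f unfolding is_operator_def by blast
  obtain N where N: "\<And>x. norm (g x) \<le> N * norm x"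
    using g unfolding is_operator_def by blast
  have "norm (f x, g x) \<le> (M + N) * norm x" for x
    using norm_Pair_le[of "f x" "g x"] M[of x] N[of x] by (simp add: algebra_simps)
  then show ?thesis
    using f g by (auto simp: is_operator_def prod_scale_def)
qed

lemma invertible_operator_inverse:
  assumes f: "invertible_operator sX sY S T f"
    and S: "\<And>x y. x \<in> S \<Longrightarrow> y \<in> S \<Longrightarrow> x + y \<in> S" "\<And>c x. x \<in> S \<Longrightarrow> sX c x \<in> S"
  shows "invertible_operator sY sX T S (inv_into S f)"
proof (rule invertible_operatorI)
  show "is_operator sY sX T S (inv_into S f)" "is_operator sX sY S T f"
    using f by (auto simp: invertible_operator_def)
  have bij: "bij_betw f S T" using f by (simp add: invertible_operator_def)
  show "f (inv_into S f y) = y" if "y \<in> T" for y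
    using bij that by (rule bij_betw_inv_into_right)
  show "inv_into S f (f x) = x" if "x \<in> S" for x
    using bij that by (rule bij_betw_inv_into_left)
qed (use S in auto)

lemma subspace_ker:
  assumes "banach_space sX" "banach_space sY" "is_operator sX sY UNIV UNIV f"
  shows "module.subspace sX (ker f)" and "closed (ker f)"
proof -
  interpret X: banach_space sX by fact
  interpret Y: banach_space sY by fact
  have bl: "bounded_linear f" and s: "\<And>c x. f (sX c x) = sY c (f x)"
    using assms(3) by (auto simp: is_operator_UNIV_iff[OF assms(1,2)])
  interpret f: bounded_linear f by fact
  show "X.subspace (ker f)"
    by (auto simp: X.subspace_def ker_def f.add s)
  show "closed (ker f)"
    unfolding ker_def by (intro closed_Collect_eq f.continuous_on continuous_on_id continuous_on_const)
qed

section \<open>The open mapping theorem for operators with closed range\<close>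

text \<open>
  The closed range is a complete metric space covered by the closures of the images of the balls of
  integer radius, so Baire's theorem gives one of them an interior point.
\<close>

lemma closed_range_interior_point:
  fixes f :: "'a::banach \<Rightarrow> 'b::banach"
  assumes cl: "closed (range f)"
  obtains n :: nat and y e where "y \<in> range f" "e > 0"
    "ball y e \<inter> range f \<subseteq> closure (f ` cball 0 (real n))"
proof -
  define R where "R = range f"
  define T where "T n = closure (f ` cball 0 (real n))" for n :: nat
  have sub: "T n \<subseteq> R" for n
    unfolding T_def R_def using cl by (intro closure_minimal) auto
  have un: "\<Union> (range T) = R"
  proof
    show "R \<subseteq> \<Union> (range T)"
    proof
      fix y assume "y \<in> R"
      then obtain x where x: "y = f x" by (auto simp: R_def)
      obtain n :: nat where "norm x \<le> real n"
        using real_arch_simple by blast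
      then have "y \<in> T n"
        unfolding T_def x by (intro closure_subset[THEN subsetD] imageI) simp
      then show "y \<in> \<Union> (range T)" by blast
    qed
  qed (use sub in auto)
  have "\<exists>n. top_of_set R interior_of T n \<noteq> {}"
  proof (rule ccontr)
    assume "\<nexists>n. top_of_set R interior_of T n \<noteq> {}"
    moreover have "closedin (top_of_set R) (T n)" for n
      using sub by (intro closed_subset) (auto simp: T_def)
    moreover have "completely_metrizable_space (top_of_set R)"
      using cl by (intro completely_metrizable_space_closedin completely_metrizable_space_euclidean)
        (simp add: R_def)
    ultimately have "top_of_set R interior_of \<Union> (range T) = {}"
      by (intro Baire_category_alt) auto
    then show False
      using interior_of_topspace[of "top_of_set R"] by (simp add: un R_def)
  qed
  then obtain n y where y: "y \<in> top_of_set R interior_of T n" by blast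
  then obtain O' where O: "openin (top_of_set R) O'" "y \<in> O'" "O' \<subseteq> T n"
    by (auto simp: interior_of_def)
  then obtain e where "e > 0" "ball y e \<inter> R \<subseteq> O'"
    by (auto simp: openin_contains_ball)
  moreover have "y \<in> R" using O openin_imp_subset by blast
  ultimately show ?thesis
    using O that[of y e n] by (auto simp: R_def T_def)
qed

text \<open>
  Differences of elements of \<open>closure (f ` cball 0 n)\<close> move the interior point to the origin: each
  small element of the range is approximated by images of vectors of norm at most \<open>2 * n\<close>.
  By homogeneity the relative error can be made \<open>1 / 2\<close> everywhere, with a uniform constant \<open>k\<close>.
\<close>

lemma closed_range_approximate_preimage:
  fixes f :: "'a::banach \<Rightarrow> 'b::banach"
  assumes f: "bounded_linear f" and cl: "closed (range f)"
  obtains k where "k \<ge> 0"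
    "\<And>y. y \<in> range f \<Longrightarrow> \<exists>x. norm x \<le> k * norm y \<and> norm (y - f x) \<le> norm y / 2"
proof -
  interpret f: bounded_linear f by fact
  obtain n :: nat and y0 e where y0: "y0 \<in> range f" and e: "e > 0"
    and sub: "ball y0 e \<inter> range f \<subseteq> closure (f ` cball 0 (real n))"
    using closed_range_interior_point[of f] cl by metis
  have small: "\<exists>x. norm x \<le> 2 * real n \<and> norm (y - f x) < e / 4"
    if y: "y \<in> range f" "norm y < e" for y
  proof -
    have "y0 + y \<in> range f"
      using y0 y(1) by (auto simp flip: f.add)
    then have "y0 + y \<in> closure (f ` cball 0 (real n))" "y0 \<in> closure (f ` cball 0 (real n))"
      using sub y0 y(2) e by (simp_all add: subset_iff dist_norm)
    moreover have "e / 8 > 0" using e by simp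
    ultimately have "\<exists>z\<in>f ` cball 0 (real n). dist z (y0 + y) < e / 8"
        "\<exists>z\<in>f ` cball 0 (real n). dist z y0 < e / 8"
      unfolding closure_approachable by blast+
    then obtain a b where ab: "norm a \<le> real n" "dist (f a) (y0 + y) < e / 8"
        "norm b \<le> real n" "dist (f b) y0 < e / 8"
      by auto
    have "norm (y - f (a - b)) = norm ((f b - y0) - (f a - (y0 + y)))"
      by (simp add: f.diff algebra_simps)
    also have "\<dots> < e / 4"
      using norm_triangle_ineq4[of "f b - y0" "f a - (y0 + y)"] ab by (simp add: dist_norm)
    finally show ?thesis
      using ab norm_triangle_ineq4[of a b] by (intro exI[of _ "a - b"]) auto
  qed
  have "\<exists>x. norm x \<le> (4 * real n / e) * norm y \<and> norm (y - f x) \<le> norm y / 2"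
    if y: "y \<in> range f" for y
  proof (cases "y = 0")
    case False
    \<comment> \<open>Rescale \<open>y\<close> to norm \<open>e / 2\<close>.\<close>
    define t where "t = e / (2 * norm y)"
    have t: "t > 0" using e False by (simp add: t_def)
    have "t *\<^sub>R y \<in> range f"
      using y by (auto simp flip: f.scaleR)
    moreover have "norm (t *\<^sub>R y) < e"
      using e False by (simp add: t_def)
    ultimately obtain x where x: "norm x \<le> 2 * real n" "norm (t *\<^sub>R y - f x) < e / 4"
      using small by blast
    have "norm (x /\<^sub>R t) = norm x / t"
      using t by (simp add: divide_inverse mult.commute)
    also have "\<dots> \<le> 2 * real n / t"
      using x t by (intro divide_right_mono) auto
    also have "\<dots> = (4 * real n / e) * norm y"
      using e False by (simp add: t_def field_simps)
    finally have 1: "norm (x /\<^sub>R t) \<le> (4 * real n / e) * norm y" .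
    have "y - f (x /\<^sub>R t) = (t *\<^sub>R y - f x) /\<^sub>R t"
      using t by (simp add: f.scaleR scaleR_diff_right)
    then have "norm (y - f (x /\<^sub>R t)) = norm (t *\<^sub>R y - f x) / t"
      using t by (simp add: divide_inverse mult.commute)
    also have "\<dots> \<le> (e / 4) / t"
      using x t by (intro divide_right_mono) auto
    also have "\<dots> = norm y / 2"
      using e False by (simp add: t_def field_simps)
    finally show ?thesis using 1 by blast
  qed (auto intro: exI[of _ 0] simp: f.zero)
  then show ?thesis using e by (intro that[of "4 * real n / e"]) auto
qed

text \<open>
  Applying the approximate solution repeatedly to the remaining error halves it each time; the
  corrections form a geometrically convergent series whose sum is an exact preimage.
\<close>

lemma closed_range_bounded_preimage:
  fixes f :: "'a::banach \<Rightarrow> 'b::banach"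
  assumes f: "bounded_linear f" and cl: "closed (range f)"
  obtains k where "\<And>y. y \<in> range f \<Longrightarrow> \<exists>x. f x = y \<and> norm x \<le> k * norm y"
proof -
  interpret f: bounded_linear f by fact
  obtain k where k: "k \<ge> 0" and
    ap: "\<And>y. y \<in> range f \<Longrightarrow> \<exists>x. norm x \<le> k * norm y \<and> norm (y - f x) \<le> norm y / 2"
    using closed_range_approximate_preimage[of f] f cl by metis
  obtain a where a: "\<And>y. y \<in> range f \<Longrightarrow> norm (a y) \<le> k * norm y"
      "\<And>y. y \<in> range f \<Longrightarrow> norm (y - f (a y)) \<le> norm y / 2"
    using ap by metis
  have "\<exists>x. f x = y \<and> norm x \<le> (2 * k) * norm y" if y: "y \<in> range f" for y
  proof -
    define r where "r n = ((\<lambda>z. z - f (a z)) ^^ n) y" for n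
    have r_Suc: "r (Suc n) = r n - f (a (r n))" and r0: "r 0 = y" for n
      by (simp_all add: r_def)
    have rR: "r n \<in> range f" for n
    proof (induction n)
      case (Suc n)
      then obtain z where "r n = f z" by blast
      then show ?case by (simp add: r_Suc flip: f.diff)
    qed (simp add: r0 y)
    have rn: "norm (r n) \<le> norm y * (1 / 2) ^ n" for n
    proof (induction n)
      case (Suc n)
      show ?case using a(2)[OF rR[of n]] Suc by (simp add: r_Suc)
    qed (simp add: r0)
    have an: "norm (a (r n)) \<le> (k * norm y) * (1 / 2) ^ n" for n
    proof -
      have "norm (a (r n)) \<le> k * norm (r n)" by (rule a(1)[OF rR])
      also have "\<dots> \<le> k * (norm y * (1 / 2) ^ n)" by (intro mult_left_mono rn k)
      finally show ?thesis by (simp add: mult.assoc)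
    qed
    have geo: "(\<lambda>n. (k * norm y) * (1 / 2 :: real) ^ n) sums ((k * norm y) * 2)"
      using geometric_sums[of "1 / 2 :: real"] by (intro sums_mult) simp
    have sn: "summable (\<lambda>n. norm (a (r n)))"
      by (rule summable_comparison_test'[OF sums_summable[OF geo], of 0]) (use an in auto)
    have sm: "summable (\<lambda>n. a (r n))" by (rule summable_norm_cancel[OF sn])
    define x where "x = (\<Sum>n. a (r n))"
    have "norm x \<le> (\<Sum>n. norm (a (r n)))"
      unfolding x_def by (rule summable_norm[OF sn])
    also have "\<dots> \<le> (k * norm y) * 2"
      using suminf_le[OF an sn sums_summable[OF geo]] sums_unique[OF geo] by simp
    finally have nx: "norm x \<le> (2 * k) * norm y" by (simp add: mult_ac)
    have part: "f (\<Sum>i<n. a (r i)) = y - r n" for n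
      by (induction n) (auto simp: f.zero f.add r0 r_Suc)
    have "(\<lambda>n. \<Sum>i<n. a (r i)) \<longlonglongrightarrow> x"
      unfolding x_def by (rule summable_LIMSEQ[OF sm])
    then have l1: "(\<lambda>n. y - r n) \<longlonglongrightarrow> f x"
      using f.tendsto[of "\<lambda>n. \<Sum>i<n. a (r i)" x sequentially] by (simp add: part)
    have "(\<lambda>n. norm y * (1 / 2 :: real) ^ n) \<longlonglongrightarrow> norm y * 0"
      by (intro tendsto_mult tendsto_const LIMSEQ_realpow_zero) auto
    then have "r \<longlonglongrightarrow> 0"
      using rn by (intro Lim_null_comparison[where f = r]) (simp_all add: always_eventually)
    then have "(\<lambda>n. y - r n) \<longlonglongrightarrow> y - 0" by (intro tendsto_diff tendsto_const)
    then have "f x = y" using LIMSEQ_unique[OF l1] by simp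
    with nx show ?thesis by blast
  qed
  then show ?thesis by (rule that)
qed

section \<open>Orthogonal projections and adjoints\<close>

lemma cjg_0 [simp]: "cjg (0::'k::real_or_complex) = 0"
  using cjg_add[of 0 "0::'k"] by simp

context hilbert_space
begin

lemma ip_zero_left [simp]: "ip 0 y = 0"
  using ip_scale_left[of 0 0 y] by simp

lemma ip_zero_right [simp]: "ip x 0 = 0"
  using ip_commute[of x 0] by simp

lemma ip_eq_0_commute: "ip x y = 0 \<longleftrightarrow> ip y x = 0"
  using ip_commute[of x y] ip_commute[of y x] by auto

lemma ip_minus_left: "ip (- x) y = - ip x y"
  using ip_add_left[of x "- x" y] by (simp add: eq_neg_iff_add_eq_0 add.commute)

lemma ip_diff_left: "ip (x - y) z = ip x z - ip y z"
  using ip_add_left[of x "- y" z] by (simp add: ip_minus_left)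

lemma ip_add_right: "ip x (y + z) = ip x y + ip x z"
  using ip_commute[of x "y + z"] ip_commute[of x y] ip_commute[of x z]
  by (simp add: ip_add_left cjg_add)

lemma ip_scale_right: "ip x (scale c y) = cjg c * ip x y"
  using ip_commute[of x "scale c y"] ip_commute[of x y] by (simp add: ip_scale_left cjg_mult)

lemma ip_minus_right: "ip x (- y) = - ip x y"
  using ip_add_right[of x y "- y"] by (simp add: eq_neg_iff_add_eq_0 add.commute)

lemma ip_diff_right: "ip x (y - z) = ip x y - ip x z"
  using ip_add_right[of x y "- z"] by (simp add: ip_minus_right)

lemma ip_self_eq_0 [simp]: "ip x x = 0 \<longleftrightarrow> x = 0"
  by (simp add: ip_self)

lemma pythagoras:
  assumes "ip x y = 0"
  shows "(norm (x + y))\<^sup>2 = (norm x)\<^sup>2 + (norm y)\<^sup>2"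
proof -
  have "ip y x = 0" using assms ip_eq_0_commute by blast
  then have "(of_real ((norm (x + y))\<^sup>2) :: 'k) = of_real ((norm x)\<^sup>2 + (norm y)\<^sup>2)"
    using assms ip_self[of "x + y"] ip_self[of x] ip_self[of y]
    by (simp add: ip_add_left ip_add_right)
  then show ?thesis by (simp only: of_real_eq_iff)
qed

lemma parallelogram:
  fixes x y :: 'a
  shows "(norm (x + y))\<^sup>2 + (norm (x - y))\<^sup>2 = 2 * (norm x)\<^sup>2 + 2 * (norm y)\<^sup>2"
proof -
  have "ip (x + y) (x + y) + ip (x - y) (x - y) = 2 * ip x x + 2 * ip y y"
    by (simp add: ip_add_left ip_add_right ip_diff_left ip_diff_right)
  then have "(of_real ((norm (x + y))\<^sup>2 + (norm (x - y))\<^sup>2) :: 'k) =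
      of_real (2 * (norm x)\<^sup>2 + 2 * (norm y)\<^sup>2)"
    by (simp add: ip_self)
  then show ?thesis by (simp only: of_real_eq_iff)
qed

text \<open>
  Subtracting from \<open>w\<close> its component along \<open>z\<close> lowers the squared norm by a known amount. This gives
  the Cauchy-Schwarz inequality, as well as the orthogonality of the error of a best approximation.
\<close>

lemma remove_component:
  assumes "z \<noteq> 0"
  obtains c where "(norm w)\<^sup>2 = (norm (w - scale c z))\<^sup>2 + (norm (ip w z))\<^sup>2 / (norm z)\<^sup>2"
proof -
  define c where "c = ip w z / of_real ((norm z)\<^sup>2)"
  have "ip (w - scale c z) z = 0"
    using assms by (simp add: c_def ip_diff_left ip_scale_left ip_self)
  then have "ip (w - scale c z) (scale c z) = 0"
    by (simp add: ip_scale_right)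
  from pythagoras[OF this] have "(norm w)\<^sup>2 = (norm (w - scale c z))\<^sup>2 + (norm (scale c z))\<^sup>2"
    by simp
  moreover have "(norm (scale c z))\<^sup>2 = (norm (ip w z))\<^sup>2 / (norm z)\<^sup>2"
    using assms by (simp add: norm_scale c_def norm_divide norm_mult power2_eq_square)
  ultimately show ?thesis using that by simp
qed

lemma cauchy_schwarz: "norm (ip x y) \<le> norm x * norm y"
proof (cases "y = 0")
  case False
  obtain c where "(norm x)\<^sup>2 = (norm (x - scale c y))\<^sup>2 + (norm (ip x y))\<^sup>2 / (norm y)\<^sup>2"
    using remove_component[OF False] by blast
  then have "(norm (ip x y))\<^sup>2 / (norm y)\<^sup>2 \<le> (norm x)\<^sup>2" by simp
  then have "(norm (ip x y))\<^sup>2 \<le> (norm x * norm y)\<^sup>2"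
    using False by (simp add: divide_le_eq power_mult_distrib)
  then show ?thesis by (rule power2_le_imp_le) simp
qed simp

text \<open>
  By the parallelogram law, two nearly optimal points of \<open>L\<close> are close to each other, because their
  midpoint also lies in \<open>L\<close> and cannot beat the infimum of the distances. Thus every minimising
  sequence is Cauchy.
\<close>

lemma nearest_point:
  assumes L: "subspace L" "closed L"
  obtains m where "m \<in> L" "\<And>z. z \<in> L \<Longrightarrow> norm (x - m) \<le> norm (x - z)"
proof -
  define d where "d = infdist x L"
  have ne: "L \<noteq> {}" using L subspace_0 by blast
  have d: "d \<le> norm (x - z)" if "z \<in> L" for z
    using infdist_le[OF that, of x] by (simp add: d_def dist_norm)
  have d0: "d \<ge> 0" by (simp add: d_def infdist_nonneg)
  have "\<exists>m\<in>L. (norm (x - m))\<^sup>2 < d\<^sup>2 + inverse (real (Suc n))" for n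
  proof -
    have "d < sqrt (d\<^sup>2 + inverse (real (Suc n)))"
      using d0 by (intro real_less_rsqrt) simp
    then obtain m where "m \<in> L" "dist x m < sqrt (d\<^sup>2 + inverse (real (Suc n)))"
      using ne unfolding d_def infdist_notempty[OF ne] by (auto simp: cINF_less_iff)
    then have "(norm (x - m))\<^sup>2 < (sqrt (d\<^sup>2 + inverse (real (Suc n))))\<^sup>2"
      by (intro power_strict_mono) (auto simp: dist_norm)
    then show ?thesis using \<open>m \<in> L\<close> by (auto simp: add_nonneg_nonneg)
  qed
  then obtain m where mL: "\<And>n. m n \<in> L"
      and m: "\<And>n. (norm (x - m n))\<^sup>2 < d\<^sup>2 + inverse (real (Suc n))"
    by metis
  have diff: "(norm (m i - m j))\<^sup>2 \<le> 2 * inverse (real (Suc i)) + 2 * inverse (real (Suc j))" for i j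
  proof -
    have "scale (1 / 2) (m i + m j) \<in> L"
      using L(1) mL by (intro subspace_scale subspace_add)
    moreover have "scale (1 / 2) (m i + m j) = (1 / 2) *\<^sub>R (m i + m j)"
      using scale_of_real[of "1 / 2"] by simp
    ultimately have "d \<le> norm (x - (1 / 2) *\<^sub>R (m i + m j))"
      using d by simp
    also have "\<dots> = norm ((1 / 2) *\<^sub>R ((x - m i) + (x - m j)))"
      by (rule arg_cong[where f = norm]) (simp add: algebra_simps flip: scaleR_left_distrib)
    finally have "2 * d \<le> norm ((x - m i) + (x - m j))" by simp
    then have "(2 * d)\<^sup>2 \<le> (norm ((x - m i) + (x - m j)))\<^sup>2"
      using d0 by (intro power_mono) auto
    moreover have "norm ((x - m i) - (x - m j)) = norm (m i - m j)"
      by (simp add: norm_minus_commute)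
    ultimately show ?thesis
      using parallelogram[of "x - m i" "x - m j"] m[of i] m[of j] by (simp add: power_mult_distrib)
  qed
  have "Cauchy m"
  proof (rule metric_CauchyI)
    fix e :: real assume e: "e > 0"
    obtain N where N: "inverse (real (Suc N)) < e\<^sup>2 / 4"
      using reals_Archimedean[of "e\<^sup>2 / 4"] e by auto
    have "dist (m i) (m j) < e" if "i \<ge> N" "j \<ge> N" for i j
    proof -
      have "inverse (real (Suc i)) \<le> inverse (real (Suc N))"
        "inverse (real (Suc j)) \<le> inverse (real (Suc N))"
        using that by (auto intro!: le_imp_inverse_le)
      then have "(norm (m i - m j))\<^sup>2 < e\<^sup>2"
        using diff[of i j] N by linarith
      then show ?thesis
        using e by (simp add: dist_norm power2_less_imp_less)
    qed
    then show "\<exists>N. \<forall>i\<ge>N. \<forall>j\<ge>N. dist (m i) (m j) < e" by blast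
  qed
  then obtain l where l: "m \<longlonglongrightarrow> l"
    using Cauchy_convergent_iff convergent_def by blast
  have 1: "(\<lambda>n. d\<^sup>2 + inverse (real (Suc n))) \<longlonglongrightarrow> d\<^sup>2 + 0"
    by (intro tendsto_add tendsto_const LIMSEQ_inverse_real_of_nat)
  have 2: "(\<lambda>n. (norm (x - m n))\<^sup>2) \<longlonglongrightarrow> (norm (x - l))\<^sup>2"
    by (intro tendsto_intros l)
  have "(norm (x - l))\<^sup>2 \<le> d\<^sup>2 + 0"
    by (rule LIMSEQ_le[OF 2 1]) (use m in \<open>auto intro: less_imp_le\<close>)
  then have "norm (x - l) \<le> d"
    using d0 by (auto intro: power2_le_imp_le[of "norm (x - l)" d])
  moreover have "l \<in> L"
    using l L(2) mL closed_sequentially by blast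
  ultimately show ?thesis
    using d that by (meson order_trans)
qed

lemma nearest_point_orthogonal:
  assumes L: "subspace L" and m: "m \<in> L" "\<And>z. z \<in> L \<Longrightarrow> norm (x - m) \<le> norm (x - z)"
    and z: "z \<in> L"
  shows "ip (x - m) z = 0"
proof (cases "z = 0")
  case False
  then obtain c where
    c: "(norm (x - m))\<^sup>2 = (norm (x - m - scale c z))\<^sup>2 + (norm (ip (x - m) z))\<^sup>2 / (norm z)\<^sup>2"
    using remove_component by blast
  have "norm (x - m) \<le> norm (x - (m + scale c z))"
    using m z L by (intro m(2) subspace_add subspace_scale)
  then have "(norm (x - m))\<^sup>2 \<le> (norm (x - m - scale c z))\<^sup>2"
    by (intro power_mono) (simp_all add: diff_diff_eq)
  with c have "(norm (ip (x - m) z))\<^sup>2 / (norm z)\<^sup>2 \<le> 0" by simp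
  then show ?thesis using False by (simp add: divide_le_0_iff)
qed simp

text \<open>
  The point of \<open>L\<close> nearest to \<open>x\<close> is the only one whose difference to \<open>x\<close> is orthogonal to \<open>L\<close>, and
  this characterisation makes the choice linear in \<open>x\<close>.
\<close>

lemma orthogonal_projection:
  assumes L: "subspace L" "closed L"
  obtains p where "is_operator scale scale UNIV L p" "\<And>x. x \<in> L \<Longrightarrow> p x = x"
    "\<And>x z. z \<in> L \<Longrightarrow> ip (x - p x) z = 0" "\<And>x. p x = 0 \<longleftrightarrow> (\<forall>z\<in>L. ip x z = 0)"
proof -
  have "\<exists>m. m \<in> L \<and> (\<forall>z\<in>L. ip (x - m) z = 0)" for x
    using nearest_point[OF L, of x] nearest_point_orthogonal[OF L(1)] by metis
  then obtain p where pL: "\<And>x. p x \<in> L" and orth: "\<And>x z. z \<in> L \<Longrightarrow> ip (x - p x) z = 0"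
    by metis
  have uniq: "p x = m" if "m \<in> L" "\<And>z. z \<in> L \<Longrightarrow> ip (x - m) z = 0" for x m
  proof -
    have "p x - m \<in> L" using that pL L by (intro subspace_diff)
    then have "ip (x - m) (p x - m) - ip (x - p x) (p x - m) = 0"
      using that orth by simp
    then have "ip (p x - m) (p x - m) = 0"
      by (simp flip: ip_diff_left)
    then show ?thesis by simp
  qed
  have add: "p (x + y) = p x + p y" for x y
  proof (rule uniq)
    show "p x + p y \<in> L" using L pL by (intro subspace_add)
    have "x + y - (p x + p y) = (x - p x) + (y - p y)" by simp
    then show "ip (x + y - (p x + p y)) z = 0" if "z \<in> L" for z
      using that orth by (simp only: ip_add_left) simp
  qed
  have sc: "p (scale c x) = scale c (p x)" for c x
  proof (rule uniq)
    show "scale c (p x) \<in> L" using L pL by (intro subspace_scale)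
    show "ip (scale c x - scale c (p x)) z = 0" if "z \<in> L" for z
      using that orth by (simp add: ip_scale_left flip: scale_right_diff_distrib)
  qed
  have bd: "norm (p x) \<le> 1 * norm x" for x
  proof -
    have "(norm (x - p x + p x))\<^sup>2 = (norm (x - p x))\<^sup>2 + (norm (p x))\<^sup>2"
      by (intro pythagoras orth pL)
    then have "(norm (p x))\<^sup>2 \<le> (norm x)\<^sup>2" by simp
    then show ?thesis by (auto intro: power2_le_imp_le[of "norm (p x)" "norm x"])
  qed
  have fixed: "p x = x" if "x \<in> L" for x using that by (intro uniq) auto
  have zero: "p x = 0 \<longleftrightarrow> (\<forall>z\<in>L. ip x z = 0)" for x
    using orth[of _ x] uniq[of 0 x] L(1) by (auto simp: subspace_0)
  have "is_operator scale scale UNIV L p"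
    unfolding is_operator_def using add sc bd pL by (auto intro: exI[of _ 1])
  then show ?thesis using fixed orth zero that by blast
qed

lemma orthogonal_complement:
  "subspace {x. \<forall>z\<in>L. ip x z = 0} \<and> closed {x. \<forall>z\<in>L. ip x z = 0}"
proof
  show "subspace {x. \<forall>z\<in>L. ip x z = 0}"
    by (auto simp: subspace_def ip_add_left ip_scale_left)
  have "bounded_linear (\<lambda>x. ip x z)" for z
  proof (rule bounded_linear_intro[where K = "norm z"])
    show "ip (r *\<^sub>R x) z = r *\<^sub>R ip x z" for r x
      using ip_scale_left[of "of_real r"] by (simp add: scale_of_real scaleR_conv_of_real)
  qed (auto simp: ip_add_left cauchy_schwarz)
  then have "closed (\<Inter>z\<in>L. {x. ip x z = 0})"
    by (intro closed_INT ballI closed_Collect_eq continuous_on_const)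
      (auto intro: bounded_linear.continuous_on)
  moreover have "(\<Inter>z\<in>L. {x. ip x z = 0}) = {x. \<forall>z\<in>L. ip x z = 0}" by auto
  ultimately show "closed {x. \<forall>z\<in>L. ip x z = 0}" by simp
qed

text \<open>
  A nonzero functional is determined up to a factor by its kernel, so a vector orthogonal to the kernel
  represents it after rescaling.
\<close>

lemma riesz_representation:
  assumes \<phi>: "is_operator scale (*) UNIV UNIV \<phi>"
  obtains g where "\<And>x. \<phi> x = ip x g"
proof (cases "\<forall>x. \<phi> x = 0")
  case False
  obtain M where M: "\<And>x. norm (\<phi> x) \<le> M * norm x"
    using \<phi> unfolding is_operator_def by blast
  have add: "\<phi> (x + y) = \<phi> x + \<phi> y" and sc: "\<phi> (scale c x) = c * \<phi> x" for x y c
    using \<phi> by (auto simp: is_operator_def)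
  have bl: "bounded_linear \<phi>"
    using add M sc[of "of_real _"]
    by (intro bounded_linear_intro[where K = M])
      (auto simp: mult.commute scale_of_real scaleR_conv_of_real)
  interpret bl: bounded_linear \<phi> by fact
  have "subspace (ker \<phi>)"
    by (auto simp: subspace_def ker_def add sc bl.zero)
  moreover have "closed (ker \<phi>)"
    unfolding ker_def by (intro closed_Collect_eq bl.continuous_on continuous_on_id continuous_on_const)
  ultimately obtain p where p: "is_operator scale scale UNIV (ker \<phi>) p"
      "\<And>x z. z \<in> ker \<phi> \<Longrightarrow> ip (x - p x) z = 0"
    using orthogonal_projection[of "ker \<phi>"] by metis
  obtain x0 where x0: "\<phi> x0 \<noteq> 0" using False by blast
  define z where "z = x0 - p x0"
  have "\<phi> (p x0) = 0" using p(1) by (auto simp: is_operator_def ker_def)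
  then have \<phi>z: "\<phi> z \<noteq> 0" using x0 by (simp add: z_def bl.diff)
  then have z: "z \<noteq> 0" by (auto simp: bl.zero)
  have orth: "ip x z = 0" if "\<phi> x = 0" for x
    using p(2)[of x x0] that ip_eq_0_commute by (auto simp: ker_def z_def)
  have "\<phi> x = ip x (scale (cjg (\<phi> z) / of_real ((norm z)\<^sup>2)) z)" for x
  proof -
    define c where "c = \<phi> x / \<phi> z"
    have "ip (x - scale c z) z = 0"
      by (rule orth) (simp add: bl.diff sc c_def \<phi>z)
    then have "ip x z = c * of_real ((norm z)\<^sup>2)"
      by (simp add: ip_diff_left ip_scale_left ip_self)
    moreover have "cjg (cjg (\<phi> z) / of_real ((norm z)\<^sup>2)) = \<phi> z / of_real ((norm z)\<^sup>2)"
    proof -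
      have "cjg (cjg (\<phi> z) / of_real ((norm z)\<^sup>2)) * cjg (of_real ((norm z)\<^sup>2)) = \<phi> z"
        using z by (simp add: cjg_cjg flip: cjg_mult)
      moreover have "cjg (of_real ((norm z)\<^sup>2) :: 'k) = of_real ((norm z)\<^sup>2)"
        using ip_commute[of z z] by (simp add: ip_self)
      ultimately show ?thesis using z by (simp add: field_simps)
    qed
    ultimately show ?thesis using z \<phi>z by (simp add: ip_scale_right c_def)
  qed
  then show ?thesis using that by blast
qed (use that[of 0] in simp)

text \<open>
  The Riesz theorem supplies an adjoint, so that the description in \<open>hilbert_adjoint_def\<close> denotes it,
  and its kernel is the orthogonal complement of the range.
\<close>

lemma ker_hilbert_adjoint:
  assumes f: "is_operator scale scale UNIV UNIV f"
  shows "ker (hilbert_adjoint ip ip f) = {y. \<forall>x. ip (f x) y = 0}"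
proof -
  obtain M where M: "\<And>x. norm (f x) \<le> M * norm x"
    using f unfolding is_operator_def by blast
  have "\<exists>g. \<forall>x. ip (f x) y = ip x g" for y
  proof -
    have "norm (ip (f x) y) \<le> (M * norm y) * norm x" for x
    proof -
      have "norm (ip (f x) y) \<le> norm (f x) * norm y" by (rule cauchy_schwarz)
      also have "\<dots> \<le> (M * norm x) * norm y" by (intro mult_right_mono M) simp
      finally show ?thesis by (simp add: mult_ac)
    qed
    then have "is_operator scale (*) UNIV UNIV (\<lambda>x. ip (f x) y)"
      using f unfolding is_operator_def by (auto simp: ip_add_left ip_scale_left)
    then show ?thesis by (metis riesz_representation)
  qed
  then obtain g where g: "\<And>x y. ip (f x) y = ip x (g y)" by metis
  have "h = g" if "\<forall>x y. ip (f x) y = ip x (h y)" for h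
  proof
    fix y
    have "ip (h y - g y) (h y - g y) = 0"
      using that g by (simp add: ip_diff_right)
    then show "h y = g y" by simp
  qed
  then have "hilbert_adjoint ip ip f = g"
    unfolding hilbert_adjoint_def using g by (intro the_equality) auto
  moreover have "g y = 0 \<longleftrightarrow> (\<forall>x. ip x (g y) = 0)" for y
    by (metis ip_self_eq_0 ip_zero_right)
  ultimately show ?thesis by (simp add: ker_def g)
qed

end

section \<open>Splitting off kernel and cokernel\<close>

text \<open>
  Here \<open>p\<close> is a projection onto the kernel \<open>N\<close> of \<open>U\<close>, \<open>P\<close> a projection onto a complement \<open>M\<close> of the
  range, and \<open>S\<close> inverts \<open>U\<close> between the complements; for orthogonal projections, \<open>S\<close> is the
  Moore-Penrose inverse. The definition lists the relations as rewrite rules, so that identities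
  between compositions of such operators can be verified by simplification.
\<close>

definition splitting ::
    "('k \<Rightarrow> 'a::real_normed_vector \<Rightarrow> 'a) \<Rightarrow> ('a \<Rightarrow> 'a) \<Rightarrow> 'a set \<Rightarrow> 'a set \<Rightarrow>
     ('a \<Rightarrow> 'a) \<Rightarrow> ('a \<Rightarrow> 'a) \<Rightarrow> ('a \<Rightarrow> 'a) \<Rightarrow> bool" where
  "splitting s U N M p P S \<longleftrightarrow>
     is_operator s s UNIV N p \<and> is_operator s s UNIV M P \<and> is_operator s s UNIV UNIV S \<and>
     (\<forall>x\<in>N. p x = x \<and> U x = 0) \<and> (\<forall>x\<in>M. P x = x) \<and>
     (\<forall>x. S (U x) = x - p x \<and> U (S x) = x - P x \<and> p (S x) = 0 \<and> S (P x) = 0 \<and> P (U x) = 0)"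

text \<open>
  With the orthogonal projections, \<open>S x\<close> is the solution in \<open>(ker U)\<^sup>\<bottom>\<close> of \<open>U w = r x\<close>, where \<open>r\<close>
  projects onto the range. Uniqueness of that solution gives linearity, and the open mapping theorem
  bounds it.
\<close>

lemma closed_range_splitting:
  fixes s :: "'k::real_or_complex \<Rightarrow> 'a::banach \<Rightarrow> 'a"
  assumes H: "hilbert_space s ip" and U: "is_operator s s UNIV UNIV U" and cl: "closed (range U)"
  obtains p P S where "splitting s U (ker U) (ker (hilbert_adjoint ip ip U)) p P S"
    "\<And>x. p x = 0 \<longleftrightarrow> (\<forall>z\<in>ker U. ip x z = 0)"
proof -
  interpret hilbert_space s ip by fact
  have B: "banach_space s" by unfold_locales
  have blU: "bounded_linear U" and sU: "\<And>c x. U (s c x) = s c (U x)"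
    using U is_operator_UNIV_iff[OF B B] by auto
  interpret U: bounded_linear U by fact
  obtain p where p: "is_operator s s UNIV (ker U) p" "\<And>x. x \<in> ker U \<Longrightarrow> p x = x"
      and p0: "\<And>x. p x = 0 \<longleftrightarrow> (\<forall>z\<in>ker U. ip x z = 0)"
    using orthogonal_projection[OF subspace_ker[OF B B U]] by metis
  have "subspace (range U)"
    using U.zero sU U.add unfolding subspace_def by (auto simp flip: sU U.add) (metis rangeI U.zero)
  then obtain r where r: "is_operator s s UNIV (range U) r" "\<And>x. x \<in> range U \<Longrightarrow> r x = x"
      "\<And>x z. z \<in> range U \<Longrightarrow> ip (x - r x) z = 0" "\<And>x. r x = 0 \<longleftrightarrow> (\<forall>z\<in>range U. ip x z = 0)"
    using orthogonal_projection[OF _ cl] by metis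
  define P where "P x = x - r x" for x
  have p_op: "is_operator s s UNIV UNIV p" and r_op: "is_operator s s UNIV UNIV r"
    using p(1) r(1) by (auto intro: is_operator_codomain)
  have rU: "r x \<in> range U" for x using r(1) by (auto simp: is_operator_def)
  have Up: "U (p x) = 0" for x using p(1) by (auto simp: is_operator_def ker_def)
  note plin = is_operator_zero_diff[OF p_op]
  note adj = ker_hilbert_adjoint[OF U]
  obtain k where k: "\<And>y. y \<in> range U \<Longrightarrow> \<exists>x. U x = y \<and> norm x \<le> k * norm y"
    using closed_range_bounded_preimage[OF blU cl] by metis
  then obtain b where b: "\<And>y. y \<in> range U \<Longrightarrow> U (b y) = y"
      "\<And>y. y \<in> range U \<Longrightarrow> norm (b y) \<le> k * norm y"
    by metis
  define S where "S x = b (r x) - p (b (r x))" for x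
  have US: "U (S x) = r x" for x
    using b(1)[OF rU] by (simp add: S_def U.diff Up)
  have pS: "p (S x) = 0" for x
    using p p_op by (simp add: S_def plin is_operator_def image_subset_iff)
  \<comment> \<open>These two properties determine \<open>S x\<close>.\<close>
  have S_eqI: "S x = w" if "U w = r x" "p w = 0" for x w
  proof -
    have "p (S x - w) = S x - w"
      using that by (intro p(2)) (simp add: ker_def U.diff US)
    then show ?thesis using that by (simp add: plin pS)
  qed
  have p_bl: "bounded_linear p" and r_bl: "bounded_linear r"
    and sp: "\<And>c x. p (s c x) = s c (p x)" and sr: "\<And>c x. r (s c x) = s c (r x)"
    using p_op r_op is_operator_UNIV_iff[OF B B] by auto
  have S_op: "is_operator s s UNIV UNIV S"
  proof -
    have "S (x + y) = S x + S y" for x y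
      by (rule S_eqI) (simp_all add: U.add US linear_simps[OF p_bl] linear_simps[OF r_bl] pS)
    moreover have "S (s c x) = s c (S x)" for c x
      by (rule S_eqI) (simp_all add: sU US sr sp pS)
    moreover have "\<exists>M. \<forall>x. norm (S x) \<le> M * norm x"
    proof -
      obtain Mp where Mp: "\<And>x. norm (p x) \<le> norm x * Mp" "Mp > 0"
        using bounded_linear.pos_bounded[OF p_bl] by metis
      obtain Mr where Mr: "\<And>x. norm (r x) \<le> norm x * Mr" "Mr > 0"
        using bounded_linear.pos_bounded[OF r_bl] by metis
      have "norm (S x) \<le> ((1 + Mp) * \<bar>k\<bar> * Mr) * norm x" for x
      proof -
        have "norm (b (r x)) \<le> k * norm (r x)" by (rule b(2)[OF rU])
        also have "\<dots> \<le> \<bar>k\<bar> * norm (r x)" by (intro mult_right_mono) auto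
        also have "\<dots> \<le> \<bar>k\<bar> * (norm x * Mr)" by (intro mult_left_mono Mr) auto
        finally have "(1 + Mp) * norm (b (r x)) \<le> (1 + Mp) * (\<bar>k\<bar> * (norm x * Mr))"
          using Mp by (intro mult_left_mono) auto
        moreover have "norm (S x) \<le> norm (b (r x)) + norm (p (b (r x)))"
          unfolding S_def by (rule norm_triangle_ineq4)
        ultimately show ?thesis
          using Mp(1)[of "b (r x)"] by (simp add: algebra_simps)
      qed
      then show ?thesis by blast
    qed
    ultimately show ?thesis by (simp add: is_operator_def)
  qed
  have P_op: "is_operator s s UNIV UNIV P"
    unfolding P_def by (intro is_operator_diff B is_operator_id r_op)
  have "is_operator s s UNIV (ker (hilbert_adjoint ip ip U)) P"
    by (rule is_operator_codomain[OF P_op]) (use r(3) ip_eq_0_commute in \<open>auto simp: adj P_def\<close>)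
  moreover have "P x = x" if "x \<in> ker (hilbert_adjoint ip ip U)" for x
    using that r(4)[of x] ip_eq_0_commute by (auto simp: adj P_def)
  moreover have "S (U x) = x - p x" for x
    by (rule S_eqI) (use p in \<open>auto simp: U.diff Up r(2) plin is_operator_def image_subset_iff\<close>)
  moreover have "S (P x) = 0" for x
    by (rule S_eqI) (auto simp: U.zero plin P_def is_operator_zero_diff[OF r_op] r(2)[OF rU])
  moreover have "P (U x) = 0" for x by (simp add: P_def r(2))
  ultimately have "splitting s U (ker U) (ker (hilbert_adjoint ip ip U)) p P S"
    using p S_op US pS by (auto simp: splitting_def P_def ker_def)
  then show ?thesis using p0 that by blast
qed

section \<open>Comparability of Hilbert spaces\<close>

text \<open>
  A partial isometry from \<open>L\<close> to \<open>M\<close> is represented by its graph: norm preservation makes the relation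
  single-valued and injective, extension becomes inclusion, and inversion becomes swapping.
\<close>

definition isometric_graph ::
    "('k::real_or_complex \<Rightarrow> 'a::banach \<Rightarrow> 'a) \<Rightarrow> ('k \<Rightarrow> 'b::banach \<Rightarrow> 'b) \<Rightarrow>
     'a set \<Rightarrow> 'b set \<Rightarrow> ('a \<times> 'b) set \<Rightarrow> bool" where
  "isometric_graph sX sY L M G \<longleftrightarrow>
     module.subspace (prod_scale sX sY) G \<and> G \<subseteq> L \<times> M \<and> (\<forall>(x, y)\<in>G. norm x = norm y)"

lemma subspace_prod_iff:
  assumes X: "banach_space sX" and Y: "banach_space sY"
  shows "module.subspace (prod_scale sX sY) G \<longleftrightarrow>
    (0, 0) \<in> G \<and> (\<forall>x y x' y'. (x, y) \<in> G \<longrightarrow> (x', y') \<in> G \<longrightarrow> (x + x', y + y') \<in> G) \<and>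
    (\<forall>c x y. (x, y) \<in> G \<longrightarrow> (sX c x, sY c y) \<in> G)"
proof -
  interpret W: banach_space "prod_scale sX sY" by (rule banach_space_prod_scale[OF X Y])
  show ?thesis
    by (simp add: W.subspace_def zero_prod_def prod_scale_def Ball_def split_paired_All)
qed

lemma isometric_graph_swap:
  assumes X: "banach_space sX" and Y: "banach_space sY" and G: "isometric_graph sX sY L M G"
  shows "isometric_graph sY sX M L (prod.swap ` G)"
proof -
  have *: "(y, x) \<in> prod.swap ` G \<longleftrightarrow> (x, y) \<in> G" for x y by force
  have "module.subspace (prod_scale sY sX) (prod.swap ` G)"
    using G unfolding isometric_graph_def subspace_prod_iff[OF X Y] subspace_prod_iff[OF Y X] *
    by blast
  then show ?thesis using G by (auto simp: isometric_graph_def)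
qed

lemma closed_swap:
  assumes "closed G"
  shows "closed (prod.swap ` G)"
proof -
  have "prod.swap ` G = prod.swap -` G" by force
  then show ?thesis
    using assms by (auto intro!: closed_vimage continuous_on_swap simp: continuous_on_swap)
qed

text \<open>
  Along a sequence in the graph, distances of the second components equal those of the first ones, so
  convergence of the first components forces that of the second.
\<close>

lemma domain_isometric_graph:
  assumes X: "banach_space sX" and Y: "banach_space sY"
    and G: "isometric_graph sX sY L M G" and cl: "closed G"
  shows "module.subspace sX (fst ` G)" and "closed (fst ` G)"
proof -
  interpret X: banach_space sX by fact
  interpret W: banach_space "prod_scale sX sY" by (rule banach_space_prod_scale[OF X Y])
  have sub: "W.subspace G" and iso: "\<And>x y. (x, y) \<in> G \<Longrightarrow> norm x = norm y"
    using G by (auto simp: isometric_graph_def)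
  show "X.subspace (fst ` G)"
    unfolding X.subspace_def using sub[unfolded subspace_prod_iff[OF X Y]]
    by (auto simp: image_iff) (metis fst_conv)+
  show "closed (fst ` G)"
    unfolding closed_sequential_limits
  proof safe
    fix x l assume "\<forall>n. x n \<in> fst ` G" and lim: "x \<longlonglongrightarrow> l"
    then have "\<forall>n. \<exists>y. (x n, y) \<in> G" by force
    then obtain y where y: "\<And>n. (x n, y n) \<in> G" by metis
    have d: "dist (y m) (y n) = dist (x m) (x n)" for m n
      using W.subspace_diff[OF sub y[of m] y[of n]] iso by (simp add: dist_norm)
    have "Cauchy x" using lim by (rule LIMSEQ_imp_Cauchy)
    then have "Cauchy y" by (simp add: Cauchy_def d)
    then obtain l' where "y \<longlonglongrightarrow> l'"
      using Cauchy_convergent_iff convergent_def by blast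
    then have "(\<lambda>n. (x n, y n)) \<longlonglongrightarrow> (l, l')" using lim by (intro tendsto_Pair)
    then have "(l, l') \<in> G" by (rule closed_sequentially[OF cl, rotated]) (rule y)
    then show "l \<in> fst ` G" by force
  qed
qed

lemma isometric_graph_closure:
  assumes X: "banach_space sX" and Y: "banach_space sY" and L: "closed L" and M: "closed M"
    and G: "isometric_graph sX sY L M G"
  shows "isometric_graph sX sY L M (closure G)"
proof -
  interpret X: banach_space sX by fact
  interpret Y: banach_space sY by fact
  interpret W: banach_space "prod_scale sX sY" by (rule banach_space_prod_scale[OF X Y])
  have sub: "W.subspace G" and GLM: "G \<subseteq> L \<times> M" and iso: "G \<subseteq> {z. norm (fst z) = norm (snd z)}"
    using G by (auto simp: isometric_graph_def)
  have bl: "bounded_linear (prod_scale sX sY c)" for c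
    by (intro bounded_linear_intro[where K = "norm c"])
      (simp_all add: W.scale_right_distrib W.norm_scale mult.commute flip: W.scale_of_real)
  have "W.subspace (closure G)"
    unfolding W.subspace_def
  proof safe
    show "0 \<in> closure G" using W.subspace_0[OF sub] closure_subset by blast
  next
    fix a b assume "a \<in> closure G" "b \<in> closure G"
    then obtain f g where "\<And>n. f n \<in> G" "f \<longlonglongrightarrow> a" "\<And>n. g n \<in> G" "g \<longlonglongrightarrow> b"
      unfolding closure_sequential by blast
    then have "\<And>n. f n + g n \<in> G" "(\<lambda>n. f n + g n) \<longlonglongrightarrow> a + b"
      by (auto intro: tendsto_add W.subspace_add[OF sub])
    then show "a + b \<in> closure G"
      unfolding closure_sequential by (intro exI[of _ "\<lambda>n. f n + g n"] conjI allI)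
  next
    fix a c assume "a \<in> closure G"
    then obtain f where "\<And>n. f n \<in> G" "f \<longlonglongrightarrow> a"
      unfolding closure_sequential by blast
    then have "\<And>n. prod_scale sX sY c (f n) \<in> G"
        "(\<lambda>n. prod_scale sX sY c (f n)) \<longlonglongrightarrow> prod_scale sX sY c a"
      by (auto intro: bounded_linear.tendsto[OF bl] W.subspace_scale[OF sub])
    then show "prod_scale sX sY c a \<in> closure G"
      unfolding closure_sequential by (intro exI[of _ "\<lambda>n. prod_scale sX sY c (f n)"] conjI allI)
  qed
  moreover have "closure G \<subseteq> L \<times> M"
    by (intro closure_minimal GLM closed_Times L M)
  moreover have "closure G \<subseteq> {z. norm (fst z) = norm (snd z)}"
    by (intro closure_minimal iso closed_Collect_eq continuous_intros)
  ultimately show ?thesis by (force simp: isometric_graph_def)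
qed

text \<open>
  By Pythagoras, mapping \<open>x + c u\<close> to \<open>y + c v\<close> preserves norms as soon as \<open>u\<close> and \<open>v\<close> have the same
  norm and are orthogonal to the domain and to the range.
\<close>

lemma isometric_graph_extend:
  fixes sX :: "'k::real_or_complex \<Rightarrow> 'a::banach \<Rightarrow> 'a" and sY :: "'k \<Rightarrow> 'b::banach \<Rightarrow> 'b"
  assumes HX: "hilbert_space sX ipX" and HY: "hilbert_space sY ipY"
    and L: "module.subspace sX L" and M: "module.subspace sY M"
    and G: "isometric_graph sX sY L M G"
    and u: "u \<in> L" "\<And>x. x \<in> fst ` G \<Longrightarrow> ipX x u = 0"
    and v: "v \<in> M" "\<And>y. y \<in> snd ` G \<Longrightarrow> ipY y v = 0"
    and uv: "norm u = norm v"
  shows "\<exists>G'. isometric_graph sX sY L M G' \<and> G \<subseteq> G' \<and> (u, v) \<in> G'"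
proof -
  interpret X: hilbert_space sX ipX by fact
  interpret Y: hilbert_space sY ipY by fact
  have BX: "banach_space sX" and BY: "banach_space sY" by unfold_locales
  interpret W: banach_space "prod_scale sX sY" by (rule banach_space_prod_scale[OF BX BY])
  have sub: "W.subspace G" and GLM: "G \<subseteq> L \<times> M" and iso: "\<And>x y. (x, y) \<in> G \<Longrightarrow> norm x = norm y"
    using G by (auto simp: isometric_graph_def)
  note subG = sub[unfolded subspace_prod_iff[OF BX BY]]
  define G' where "G' = {(x + sX c u, y + sY c v) | x y c. (x, y) \<in> G}"
  have G'I: "(x + sX c u, y + sY c v) \<in> G'" if "(x, y) \<in> G" for x y c
    using that by (auto simp: G'_def)
  have G'E: "\<exists>a b c. (a, b) \<in> G \<and> x = a + sX c u \<and> y = b + sY c v" if "(x, y) \<in> G'" for x y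
    using that by (auto simp: G'_def)
  have "W.subspace G'"
    unfolding subspace_prod_iff[OF BX BY]
  proof safe
    show "(0, 0) \<in> G'" using G'I[of 0 0 0] subG by simp
  next
    fix x y x' y' assume "(x, y) \<in> G'" "(x', y') \<in> G'"
    then obtain a b c a' b' c' where "(a, b) \<in> G" "(a', b') \<in> G"
      "x = a + sX c u" "y = b + sY c v" "x' = a' + sX c' u" "y' = b' + sY c' v"
      using G'E by meson
    then show "(x + x', y + y') \<in> G'"
      using G'I[of "a + a'" "b + b'" "c + c'"] subG
      by (simp add: X.scale_left_distrib Y.scale_left_distrib algebra_simps)
  next
    fix d x y assume "(x, y) \<in> G'"
    then obtain a b c where "(a, b) \<in> G" "x = a + sX c u" "y = b + sY c v"
      using G'E by meson
    then show "(sX d x, sY d y) \<in> G'"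
      using G'I[of "sX d a" "sY d b" "d * c"] subG
      by (simp add: X.scale_right_distrib Y.scale_right_distrib)
  qed
  moreover have "G' \<subseteq> L \<times> M"
    using GLM u(1) v(1) by (auto simp: G'_def intro!: X.subspace_add[OF L] X.subspace_scale[OF L]
        Y.subspace_add[OF M] Y.subspace_scale[OF M])
  moreover have "norm (x + sX c u) = norm (y + sY c v)" if "(x, y) \<in> G" for x y c
  proof -
    have "ipX x (sX c u) = 0" "ipY y (sY c v) = 0"
      using that u(2)[of x] v(2)[of y] by (force simp: X.ip_scale_right Y.ip_scale_right)+
    then have "(norm (x + sX c u))\<^sup>2 = (norm (y + sY c v))\<^sup>2"
      using iso[OF that] uv by (simp add: X.pythagoras Y.pythagoras X.norm_scale Y.norm_scale)
    then show ?thesis by simp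
  qed
  ultimately have "isometric_graph sX sY L M G'"
    by (auto simp: isometric_graph_def G'_def)
  moreover have "G \<subseteq> G'" using G'I[of _ _ 0] by auto
  moreover have "(u, v) \<in> G'" using G'I[of 0 0 1] subG by simp
  ultimately show ?thesis by blast
qed

lemma unit_vector_orthogonal:
  assumes H: "hilbert_space s ip" and L: "module.subspace s L"
    and D: "module.subspace s D" "closed D" "D \<subseteq> L" "D \<noteq> L"
  obtains u where "u \<in> L" "norm u = 1" "\<And>x. x \<in> D \<Longrightarrow> ip x u = 0"
proof -
  interpret hilbert_space s ip by fact
  obtain p where p: "is_operator s s UNIV D p" "\<And>x z. z \<in> D \<Longrightarrow> ip (x - p x) z = 0"
    using orthogonal_projection[OF D(1,2)] by metis
  obtain w where w: "w \<in> L" "w \<notin> D" using D by blast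
  have pD: "p w \<in> D" using p(1) by (auto simp: is_operator_def)
  define u where "u = w - p w"
  have u: "u \<in> L" "u \<noteq> 0"
    using w pD D(3) by (auto simp: u_def intro!: subspace_diff[OF L])
  have orth: "ip x u = 0" if "x \<in> D" for x
    using p(2)[OF that, of w] ip_eq_0_commute by (simp add: u_def)
  show ?thesis
  proof (rule that)
    show "s (of_real (1 / norm u)) u \<in> L" by (rule subspace_scale[OF L u(1)])
    show "norm (s (of_real (1 / norm u)) u) = 1"
      using u by (simp only: scale_of_real) simp
    show "ip x (s (of_real (1 / norm u)) u) = 0" if "x \<in> D" for x
      using orth[OF that] by (simp only: ip_scale_right) simp
  qed
qed

text \<open>
  Zorn's lemma yields a maximal partial isometry. It is closed, as its closure is an extension; and if
  both its domain and its range were proper, a unit vector orthogonal to each would extend it.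
\<close>

lemma maximal_isometric_graph:
  fixes sX :: "'k::real_or_complex \<Rightarrow> 'a::banach \<Rightarrow> 'a" and sY :: "'k \<Rightarrow> 'b::banach \<Rightarrow> 'b"
  assumes HX: "hilbert_space sX ipX" and HY: "hilbert_space sY ipY"
    and L: "module.subspace sX L" "closed L" and M: "module.subspace sY M" "closed M"
  obtains G where "isometric_graph sX sY L M G" "closed G" "fst ` G = L \<or> snd ` G = M"
proof -
  interpret X: hilbert_space sX ipX by fact
  interpret Y: hilbert_space sY ipY by fact
  have BX: "banach_space sX" and BY: "banach_space sY" by unfold_locales
  interpret W: banach_space "prod_scale sX sY" by (rule banach_space_prod_scale[OF BX BY])
  let ?A = "{G. isometric_graph sX sY L M G}"
  have "\<exists>G\<in>?A. \<forall>G'\<in>?A. G \<subseteq> G' \<longrightarrow> G' = G"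
  proof (rule subset_Zorn_nonempty)
    have "{0} \<in> ?A"
      using X.subspace_0[OF L(1)] Y.subspace_0[OF M(1)]
      by (auto simp: isometric_graph_def zero_prod_def subspace_prod_iff[OF BX BY])
    then show "?A \<noteq> {}" by blast
  next
    fix \<C> assume ne: "\<C> \<noteq> {}" and ch: "subset.chain ?A \<C>"
    have sub: "W.subspace G" if "G \<in> \<C>" for G
      using ch that by (auto simp: subset_chain_def isometric_graph_def)
    have "W.subspace (\<Union>\<C>)"
      unfolding W.subspace_def
    proof safe
      show "0 \<in> \<Union>\<C>" using ne sub W.subspace_0 by blast
    next
      fix a b G G' assume G: "a \<in> G" "G \<in> \<C>" "b \<in> G'" "G' \<in> \<C>"
      then have "G \<subseteq> G' \<or> G' \<subseteq> G" using ch by (auto simp: subset_chain_def)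
      then show "a + b \<in> \<Union>\<C>" using G sub W.subspace_add by blast
    next
      fix c a G assume "a \<in> G" "G \<in> \<C>"
      then show "prod_scale sX sY c a \<in> \<Union>\<C>" using sub W.subspace_scale by blast
    qed
    then show "\<Union>\<C> \<in> ?A"
      using ch by (fastforce simp: subset_chain_def isometric_graph_def)
  qed
  then obtain G where G: "isometric_graph sX sY L M G"
      and max: "\<And>G'. isometric_graph sX sY L M G' \<Longrightarrow> G \<subseteq> G' \<Longrightarrow> G' = G"
    by auto
  have "closure G = G"
    by (intro max isometric_graph_closure BX BY L M G closure_subset)
  then have cl: "closed G" by (metis closed_closure)
  have GLM: "fst ` G \<subseteq> L" "snd ` G \<subseteq> M" using G by (auto simp: isometric_graph_def)
  have "fst ` G = L \<or> snd ` G = M"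
  proof (rule ccontr)
    assume neg: "\<not> (fst ` G = L \<or> snd ` G = M)"
    have "fst ` prod.swap ` G = snd ` G" by force
    note dom = domain_isometric_graph[OF BX BY G cl]
      domain_isometric_graph[OF BY BX isometric_graph_swap[OF BX BY G] closed_swap[OF cl], unfolded this]
    obtain u where u: "u \<in> L" "norm u = 1" "\<And>x. x \<in> fst ` G \<Longrightarrow> ipX x u = 0"
      using unit_vector_orthogonal[OF HX L(1) dom(1,2) GLM(1)] neg by metis
    obtain v where v: "v \<in> M" "norm v = 1" "\<And>y. y \<in> snd ` G \<Longrightarrow> ipY y v = 0"
      using unit_vector_orthogonal[OF HY M(1) dom(3,4) GLM(2)] neg by metis
    obtain G' where "isometric_graph sX sY L M G'" "G \<subseteq> G'" "(u, v) \<in> G'"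
      using isometric_graph_extend[OF HX HY L(1) M(1) G u(1,3) v(1,3)] u(2) v(2) by auto
    then have "u \<in> fst ` G" using max by force
    then have "ipX u u = 0" by (rule u(3))
    then show False using u(2) by simp
  qed
  then show ?thesis using G cl that by blast
qed

text \<open>
  The left inverse \<open>js\<close> is defined on the whole space and vanishes on \<open>M\<^sup>\<bottom>\<close>, so that \<open>j \<circ> js\<close> is a
  projection onto the copy of \<open>L\<close> inside \<open>M\<close> that kills the vectors orthogonal to \<open>M\<close>.
\<close>

definition complemented_embedding ::
    "('k \<Rightarrow> 'a::real_normed_vector \<Rightarrow> 'a) \<Rightarrow> ('k \<Rightarrow> 'b::real_normed_vector \<Rightarrow> 'b) \<Rightarrow>
     ('b \<Rightarrow> 'b \<Rightarrow> 'k::zero) \<Rightarrow> 'a set \<Rightarrow> 'b set \<Rightarrow> ('a \<Rightarrow> 'b) \<Rightarrow> ('b \<Rightarrow> 'a) \<Rightarrow> bool" where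
  "complemented_embedding sX sY ipY L M j js \<longleftrightarrow>
     is_operator sX sY L M j \<and> is_operator sY sX UNIV L js \<and> (\<forall>x\<in>L. js (j x) = x) \<and>
     (\<forall>y. (\<forall>z\<in>M. ipY y z = 0) \<longrightarrow> js y = 0)"

text \<open>
  The left inverse is the orthogonal projection onto the range of the graph, followed by the inverse
  isometry.
\<close>

lemma complemented_embedding_of_graph:
  fixes sX :: "'k::real_or_complex \<Rightarrow> 'a::banach \<Rightarrow> 'a" and sY :: "'k \<Rightarrow> 'b::banach \<Rightarrow> 'b"
  assumes X: "banach_space sX" and HY: "hilbert_space sY ipY"
    and G: "isometric_graph sX sY L M G" "closed G" and dom: "fst ` G = L"
  shows "\<exists>j js. complemented_embedding sX sY ipY L M j js"
proof -
  interpret X: banach_space sX by fact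
  interpret Y: hilbert_space sY ipY by fact
  have Y: "banach_space sY" by unfold_locales
  interpret W: banach_space "prod_scale sX sY" by (rule banach_space_prod_scale[OF X Y])
  have sub: "W.subspace G" and GLM: "G \<subseteq> L \<times> M" and iso: "\<And>x y. (x, y) \<in> G \<Longrightarrow> norm x = norm y"
    using G(1) by (auto simp: isometric_graph_def)
  note subG = sub[unfolded subspace_prod_iff[OF X Y]]
  have uniq: "y = y' \<longleftrightarrow> x = x'" if "(x, y) \<in> G" "(x', y') \<in> G" for x y x' y'
    using W.subspace_diff[OF sub that] iso[of "x - x'" "y - y'"] by auto
  have "fst ` prod.swap ` G = snd ` G" by force
  note ran = domain_isometric_graph[OF Y X isometric_graph_swap[OF X Y G(1)] closed_swap[OF G(2)],
      unfolded this]
  obtain q where q: "is_operator sY sY UNIV (snd ` G) q" "\<And>y. y \<in> snd ` G \<Longrightarrow> q y = y"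
      "\<And>y. q y = 0 \<longleftrightarrow> (\<forall>z\<in>snd ` G. ipY y z = 0)"
    using Y.orthogonal_projection[OF ran] by metis
  have "\<forall>x\<in>L. \<exists>y. (x, y) \<in> G" by (auto simp flip: dom)
  then obtain j where j: "\<And>x. x \<in> L \<Longrightarrow> (x, j x) \<in> G" by metis
  have "\<forall>y\<in>snd ` G. \<exists>x. (x, y) \<in> G" by auto
  then obtain h where h: "\<And>y. y \<in> snd ` G \<Longrightarrow> (h y, y) \<in> G" by metis
  have L: "X.subspace L" using domain_isometric_graph(1)[OF X Y G] dom by simp
  have "is_operator sX sY L M j"
    unfolding is_operator_def
  proof (intro conjI ballI allI)
    show "j ` L \<subseteq> M" using j GLM by auto
    show "j (x + y) = j x + j y" if "x \<in> L" "y \<in> L" for x y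
      using j[OF that(1)] j[OF that(2)] j[OF X.subspace_add[OF L that]] uniq subG by metis
    show "j (sX c x) = sY c (j x)" if "x \<in> L" for c x
      using j[OF that] j[OF X.subspace_scale[OF L that]] uniq subG by metis
    show "\<exists>N. \<forall>x\<in>L. norm (j x) \<le> N * norm x"
      using iso[OF j] by (intro exI[of _ 1]) auto
  qed
  moreover have "is_operator sY sX (snd ` G) L h"
    unfolding is_operator_def
  proof (intro conjI ballI allI)
    show "h ` snd ` G \<subseteq> L" using h GLM by auto
    show "h (x + y) = h x + h y" if "x \<in> snd ` G" "y \<in> snd ` G" for x y
      using h[OF that(1)] h[OF that(2)] h[OF Y.subspace_add[OF ran(1) that]] uniq subG by metis
    show "h (sY c x) = sX c (h x)" if "x \<in> snd ` G" for c x
      using h[OF that] h[OF Y.subspace_scale[OF ran(1) that]] uniq subG by metis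
    show "\<exists>N. \<forall>x\<in>snd ` G. norm (h x) \<le> N * norm x"
      using iso[OF h] by (intro exI[of _ 1]) auto
  qed
  then have "is_operator sY sX UNIV L (\<lambda>y. h (q y))" by (rule is_operator_comp[OF q(1)])
  moreover have "h (q (j x)) = x" if "x \<in> L" for x
  proof -
    have "j x \<in> snd ` G" using j[OF that] by force
    then show ?thesis using h[of "j x"] j[OF that] uniq q(2) by metis
  qed
  moreover have "h (q y) = 0" if "\<forall>z\<in>M. ipY y z = 0" for y
  proof -
    have "q y = 0" using that GLM by (auto simp: q(3))
    moreover have "(0::'b) \<in> snd ` G" using ran(1) by (rule Y.subspace_0)
    ultimately show ?thesis using h[of 0] subG uniq by auto
  qed
  ultimately show ?thesis unfolding complemented_embedding_def by blast
qed

text \<open>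
  A maximal partial isometry exhausts \<open>L\<close> or \<open>M\<close>; it or its inverse is then an embedding.
\<close>

lemma hilbert_spaces_comparable:
  fixes sX :: "'k::real_or_complex \<Rightarrow> 'a::banach \<Rightarrow> 'a" and sY :: "'k \<Rightarrow> 'b::banach \<Rightarrow> 'b"
  assumes HX: "hilbert_space sX ipX" and HY: "hilbert_space sY ipY"
    and L: "module.subspace sX L" "closed L" and M: "module.subspace sY M" "closed M"
  shows "(\<exists>j js. complemented_embedding sX sY ipY L M j js) \<or>
    (\<exists>j js. complemented_embedding sY sX ipX M L j js)"
proof -
  interpret X: hilbert_space sX ipX by fact
  interpret Y: hilbert_space sY ipY by fact
  have BX: "banach_space sX" and BY: "banach_space sY" by unfold_locales
  obtain G where G: "isometric_graph sX sY L M G" "closed G" "fst ` G = L \<or> snd ` G = M"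
    by (rule maximal_isometric_graph[OF HX HY L M])
  have "fst ` prod.swap ` G = snd ` G" by force
  then show ?thesis
    using complemented_embedding_of_graph[OF BX HY G(1,2)] G(3)
      complemented_embedding_of_graph[OF BY HX isometric_graph_swap[OF BX BY G(1)] closed_swap[OF G(2)]]
    by auto
qed

section \<open>Schur coupling from matching kernels and cokernels\<close>

text \<open>
  Swapping both rows and columns of the coupling matrix exchanges the two Schur complements.
\<close>

lemma schur_coupled_commute:
  assumes "schur_coupled sX sY U V"
  shows "schur_coupled sY sX V U"
  using assms unfolding schur_coupled_def by blast

text \<open>
  Let \<open>Q\<close> be the complement, inside the kernel of \<open>p'\<close>, of the range of \<open>j\<close>. Then
  \<open>V = E (U \<oplus> I\<^sub>Q) F\<close> for invertible operators \<open>F\<close> from \<open>Y\<close> to \<open>X \<oplus> Q\<close> and \<open>E\<close> from \<open>X \<oplus> Q\<close> to \<open>Y\<close>: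
  \<open>F\<close> undoes \<open>j\<close> and \<open>K\<close> and keeps \<open>Q\<close>, while \<open>E\<close> maps \<open>U x + m\<close> to \<open>V (j x) + L m\<close> for \<open>m\<close> in \<open>M\<close>, and
  \<open>q\<close> to \<open>V q\<close>. Writing \<open>G\<close> for the first component of \<open>F\<close> and \<open>C\<close> for the restriction of \<open>E\<close> to \<open>X\<close>,
  the coupling matrix has the entries \<open>I\<close>, \<open>(I - U) G\<close>, \<open>C\<close> and \<open>D = E F\<close>: then
  \<open>I - (I - U) G D\<^sup>-\<^sup>1 C = U\<close> as \<open>G D\<^sup>-\<^sup>1 C = I\<close>, and \<open>D - C (I - U) G = V\<close>.
\<close>

lemma schur_coupled_if_splittings_match:
  fixes sX :: "'k::real_or_complex \<Rightarrow> 'a::banach \<Rightarrow> 'a" and sY :: "'k \<Rightarrow> 'b::banach \<Rightarrow> 'b"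
  assumes X: "banach_space sX" and Y: "banach_space sY"
    and U: "is_operator sX sX UNIV UNIV U" and V: "is_operator sY sY UNIV UNIV V"
    and spX: "splitting sX U N M p P S" and spY: "splitting sY V N' M' p' P' S'"
    and K: "invertible_operator sX sY N N' K" and L: "invertible_operator sX sY M M' L"
    and j: "is_operator sX sY UNIV UNIV j" and js: "is_operator sY sX UNIV UNIV js"
    and jsj: "\<And>x. js (j x) = x - p x" and p'j: "\<And>x. p' (j x) = 0" and jp: "\<And>x. j (p x) = 0"
    and pjs: "\<And>y. p (js y) = 0" and jsp': "\<And>y. js (p' y) = 0"
  shows "schur_coupled sX sY U V"
proof -
  define K' where "K' = inv_into N K"
  define L' where "L' = inv_into M L"
  have K': "is_operator sY sX N' N K'" and L': "is_operator sY sX M' M L'"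
    and bij: "bij_betw K N N'" "bij_betw L M M'"
    and Kop: "is_operator sX sY N N' K" and Lop: "is_operator sX sY M M' L"
    using K L by (auto simp: invertible_operator_def K'_def L'_def)
  have p: "is_operator sX sX UNIV N p" and P: "is_operator sX sX UNIV M P"
    and S: "is_operator sX sX UNIV UNIV S"
    and p': "is_operator sY sY UNIV N' p'" and P': "is_operator sY sY UNIV M' P'"
    and S': "is_operator sY sY UNIV UNIV S'"
    using spX spY by (auto simp: splitting_def)
  have mem: "p x \<in> N" "P x \<in> M" "p' y \<in> N'" "P' y \<in> M'" for x y
    using p P p' P' by (auto simp: is_operator_def)
  have mem2: "x \<in> N \<Longrightarrow> K x \<in> N'" "x \<in> M \<Longrightarrow> L x \<in> M'" "y \<in> N' \<Longrightarrow> K' y \<in> N" "y \<in> M' \<Longrightarrow> L' y \<in> M" for x y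
    using Kop Lop K' L' by (auto simp: is_operator_def)
  have invs: "x \<in> N \<Longrightarrow> K' (K x) = x" "x \<in> M \<Longrightarrow> L' (L x) = x" "y \<in> N' \<Longrightarrow> K (K' y) = y" "y \<in> M' \<Longrightarrow> L (L' y) = y" for x y
    using bij by (simp_all add: K'_def L'_def bij_betw_inv_into_left bij_betw_inv_into_right)
  have X1: "x \<in> N \<Longrightarrow> p x = x" "x \<in> N \<Longrightarrow> U x = 0" "x \<in> M \<Longrightarrow> P x = x"
    "S (U x) = x - p x" "U (S x) = x - P x" "p (S x) = 0" "S (P x) = 0" "P (U x) = 0" for x
    using spX by (auto simp: splitting_def)
  have Y1: "y \<in> N' \<Longrightarrow> p' y = y" "y \<in> N' \<Longrightarrow> V y = 0" "y \<in> M' \<Longrightarrow> P' y = y"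
    "S' (V y) = y - p' y" "V (S' y) = y - P' y" "p' (S' y) = 0" "S' (P' y) = 0" "P' (V y) = 0" for y
    using spY by (auto simp: splitting_def)
  \<comment> \<open>Extended by zero along the complements, \<open>K\<close>, \<open>L\<close> and their inverses become operators on
    whole spaces, and only compositions of such operators remain.\<close>
  define k where "k x = K (p x)" for x
  define l where "l x = L (P x)" for x
  define k' where "k' y = K' (p' y)" for y
  define l' where "l' y = L' (P' y)" for y
  have k: "is_operator sX sY UNIV UNIV k"
    using is_operator_comp[OF p Kop] by (auto simp: k_def[abs_def] intro: is_operator_codomain)
  have l: "is_operator sX sY UNIV UNIV l"
    using is_operator_comp[OF P Lop] by (auto simp: l_def[abs_def] intro: is_operator_codomain)
  have k': "is_operator sY sX UNIV UNIV k'"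
    using is_operator_comp[OF p' K'] by (auto simp: k'_def[abs_def] intro: is_operator_codomain)
  have l': "is_operator sY sX UNIV UNIV l'"
    using is_operator_comp[OF P' L'] by (auto simp: l'_def[abs_def] intro: is_operator_codomain)
  have pU: "is_operator sX sX UNIV UNIV p" and PU: "is_operator sX sX UNIV UNIV P"
    and p'U: "is_operator sY sY UNIV UNIV p'" and P'U: "is_operator sY sY UNIV UNIV P'"
    using p P p' P' by (auto intro: is_operator_codomain)
  have add: "f (x + y) = f x + f y" if "is_operator s t UNIV UNIV f"
    for f :: "'u::banach \<Rightarrow> 'v::banach" and s :: "'k \<Rightarrow> 'u \<Rightarrow> 'u" and t :: "'k \<Rightarrow> 'v \<Rightarrow> 'v" and x y
    using that by (auto simp: is_operator_def)
  note ops = U V pU PU S p'U P'U S' k l k' l' j js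
  note lin = ops[THEN add] ops[THEN is_operator_zero_diff(1)] ops[THEN is_operator_zero_diff(2)]
  note rel = X1(4-) Y1(4-)
  have k_rel: "k' (k x) = p x" "k (k' y) = p' y" "p' (k x) = k x" "k (p x) = k x"
      "k' (p' y) = k' y" "p (k' y) = k' y" "V (k x) = 0" "U (k' y) = 0" "U (p x) = 0" "V (p' y) = 0"
      "p (p x) = p x" "p' (p' y) = p' y" for x y
    by (simp_all add: k_def k'_def mem mem2 invs X1(1,2) Y1(1,2))
  have l_rel: "l' (l x) = P x" "l (l' y) = P' y" "l (P x) = l x" "l' (P' y) = l' y"
      "P (l' y) = l' y" "P' (l x) = l x" "P (P x) = P x" "P' (P' y) = P' y" for x y
    by (simp_all add: l_def l'_def mem mem2 invs X1(3) Y1(3))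
  have van: "l (U x) = 0" "l' (V y) = 0" "k (S x) = 0" "k' (S' y) = 0" "k' (j x) = 0" "k (js y) = 0"
      "S (l' y) = 0" "S' (l x) = 0" "j (k' y) = 0" "js (k x) = 0" for x y
  proof -
    show "l (U x) = 0" "l' (V y) = 0"
      using l_rel(3)[of "U x"] l_rel(4)[of "V y"] by (simp_all add: X1 Y1 lin)
    show "k (S x) = 0" "k' (S' y) = 0" "k' (j x) = 0" "k (js y) = 0"
      using k_rel(4)[of "S x"] k_rel(5)[of "S' y"] k_rel(5)[of "j x"] k_rel(4)[of "js y"]
      by (simp_all add: X1 Y1 p'j pjs lin)
    show "S (l' y) = 0" "S' (l x) = 0"
      using X1(7)[of "l' y"] Y1(7)[of "l x"] by (simp_all add: l_rel)
    show "j (k' y) = 0" "js (k x) = 0"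
      using jp[of "k' y"] jsp'[of "k x"] by (simp_all add: k_rel)
  qed
  \<comment> \<open>\<open>q\<close> projects onto \<open>Q\<close>, and \<open>D'\<close> is the inverse \<open>F\<^sup>-\<^sup>1 E\<^sup>-\<^sup>1\<close> of \<open>D\<close>: its summands restore the
    components in \<open>Q\<close>, in the range of \<open>j\<close> and in \<open>N'\<close>.\<close>
  define q where "q y = y - p' y - j (js y)" for y
  define G where "G y = js y + k' y" for y
  define C where "C x = V (j (S x)) + l x" for x
  define D where "D y = V (q y) + C (G y)" for y
  define D' where "D' y = q (S' y) + (j (U (js (S' y)) + l' y) + k (U (js (S' y)) + l' y))" for y
  define B where "B y = G y - U (G y)" for y
  have q: "is_operator sY sY UNIV UNIV q"
    unfolding q_def[abs_def] by (intro is_operator_diff Y is_operator_id p'U is_operator_comp[OF js j])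
  have G: "is_operator sY sX UNIV UNIV G"
    unfolding G_def[abs_def] by (intro is_operator_add X Y js k')
  have C: "is_operator sX sY UNIV UNIV C"
    unfolding C_def[abs_def]
    by (intro is_operator_add X Y l is_operator_comp[OF is_operator_comp[OF S j] V])
  have D: "is_operator sY sY UNIV UNIV D"
    unfolding D_def[abs_def]
    by (intro is_operator_add Y is_operator_comp[OF q V] is_operator_comp[OF G C])
  have B: "is_operator sY sX UNIV UNIV B"
    unfolding B_def[abs_def] by (intro is_operator_diff X Y G is_operator_comp[OF G U])
  have h: "is_operator sY sX UNIV UNIV (\<lambda>y. U (js (S' y)) + l' y)"
    by (intro is_operator_add X Y l' is_operator_comp[OF is_operator_comp[OF S' js] U])
  have D': "is_operator sY sY UNIV UNIV D'"
    unfolding D'_def[abs_def]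
    by (intro is_operator_add Y is_operator_comp[OF S' q] is_operator_comp[OF h j] is_operator_comp[OF h k])
  note all = rel k_rel l_rel van jsj p'j jp pjs jsp'
  have GD': "G (D' y) = U (js (S' y)) + l' y" for y
    by (simp add: G_def D'_def q_def lin all)
  have qD': "q (D' y) = q (S' y)" for y
    by (simp add: D'_def q_def lin all)
  have DD': "D (D' y) = y" for y
    unfolding D_def GD' qD' by (simp add: C_def q_def lin all)
  have UG: "U (G y) = U (js y)" for y
    by (simp add: G_def lin all)
  have V_eq: "V y = V (q y) + C (U (G y))" for y
    unfolding UG by (simp add: C_def q_def lin all)
  have D'D: "D' (D y) = y" for y
    by (simp add: D_def D'_def C_def G_def q_def lin all)
  have invD: "inv D = D'"
    using D'D DD' by (intro inv_unique_comp) auto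
  have "invertible_operator sY sY UNIV UNIV D"
    by (rule invertible_operatorI[OF D D']) (use D'D DD' in auto)
  moreover have "invertible_operator sX sX UNIV UNIV (\<lambda>x. x)"
    by (rule invertible_operatorI[OF is_operator_id is_operator_id]) auto
  moreover have "U = (\<lambda>x. x - B (inv D (C x)))"
  proof
    fix x
    have "G (D' (C x)) = x"
      unfolding GD' by (simp add: C_def lin all)
    then show "U x = x - B (inv D (C x))" by (simp add: invD B_def)
  qed
  moreover have "V = (\<lambda>y. D y - C (inv (\<lambda>x. x) (B y)))"
  proof
    fix y
    have "inv (\<lambda>x::'a. x) = (\<lambda>x. x)" by (intro inv_unique_comp) auto
    then show "V y = D y - C (inv (\<lambda>x. x) (B y))"
      by (simp add: V_eq[of y] D_def B_def is_operator_zero_diff[OF C])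
  qed
  ultimately show ?thesis
    unfolding schur_coupled_def using is_operator_id B C D by blast
qed

text \<open>
  The embedding \<open>j\<close> is only meaningful on \<open>(ker U)\<^sup>\<bottom>\<close>; composing it with the orthogonal projection
  \<open>x \<mapsto> x - p x\<close> onto that space gives an operator on all of \<open>X\<close>.
\<close>

lemma schur_coupled_if_embedding:
  fixes sX :: "'k::real_or_complex \<Rightarrow> 'a::banach \<Rightarrow> 'a" and sY :: "'k \<Rightarrow> 'b::banach \<Rightarrow> 'b"
  assumes HX: "hilbert_space sX ipX" and HY: "hilbert_space sY ipY"
    and U: "is_operator sX sX UNIV UNIV U" "closed (range U)"
    and V: "is_operator sY sY UNIV UNIV V" "closed (range V)"
    and K: "invertible_operator sX sY (ker U) (ker V) K"
    and L: "invertible_operator sX sY (ker (hilbert_adjoint ipX ipX U)) (ker (hilbert_adjoint ipY ipY V)) L"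
    and emb: "complemented_embedding sX sY ipY
      {x. \<forall>z\<in>ker U. ipX x z = 0} {y. \<forall>z\<in>ker V. ipY y z = 0} j js"
  shows "schur_coupled sX sY U V"
proof -
  interpret X: hilbert_space sX ipX by fact
  interpret Y: hilbert_space sY ipY by fact
  have BX: "banach_space sX" and BY: "banach_space sY" by unfold_locales
  obtain p P S where X: "splitting sX U (ker U) (ker (hilbert_adjoint ipX ipX U)) p P S"
      and p0: "\<And>x. p x = 0 \<longleftrightarrow> (\<forall>z\<in>ker U. ipX x z = 0)"
    using closed_range_splitting[OF HX U] by metis
  obtain p' P' S' where Y: "splitting sY V (ker V) (ker (hilbert_adjoint ipY ipY V)) p' P' S'"
      and p'0: "\<And>y. p' y = 0 \<longleftrightarrow> (\<forall>z\<in>ker V. ipY y z = 0)"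
    using closed_range_splitting[OF HY V] by metis
  have pN: "is_operator sX sX UNIV (ker U) p" and p'N: "is_operator sY sY UNIV (ker V) p'"
    using X Y by (auto simp: splitting_def)
  have p': "p' y \<in> ker V" for y using p'N by (auto simp: is_operator_def)
  have "p x \<in> ker U" for x using pN by (auto simp: is_operator_def)
  then have p: "is_operator sX sX UNIV UNIV p" "p (p x) = p x" for x
    using X pN by (auto simp: splitting_def intro: is_operator_codomain)
  note plin = is_operator_zero_diff[OF p(1)]
  have emb': "is_operator sX sY {x. p x = 0} {y. p' y = 0} j" "is_operator sY sX UNIV {x. p x = 0} js"
      "\<And>x. p x = 0 \<Longrightarrow> js (j x) = x" "\<And>y. (\<forall>z. p' z = 0 \<longrightarrow> ipY y z = 0) \<Longrightarrow> js y = 0"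
    using emb unfolding complemented_embedding_def by (auto simp: p0 p'0)
  have "is_operator sX sX UNIV {x. p x = 0} (\<lambda>x. x - p x)"
    by (rule is_operator_codomain[OF is_operator_diff[OF BX BX is_operator_id p(1)]])
      (simp add: plin p)
  from is_operator_comp[OF this emb'(1)]
  have j: "is_operator sX sY UNIV UNIV (\<lambda>x. j (x - p x))"
    by (rule is_operator_codomain) simp
  have "j (0 + 0) = j 0 + j 0"
    using emb'(1) plin(1) unfolding is_operator_def by blast
  then have "j 0 = 0" by simp
  show ?thesis
  proof (rule schur_coupled_if_splittings_match[OF BX BY U(1) V(1) X Y K L j])
    show "is_operator sY sX UNIV UNIV js" using emb'(2) by (auto intro: is_operator_codomain)
    show "js (j (x - p x)) = x - p x" for x by (intro emb') (simp add: plin p)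
    show "p' (j (x - p x)) = 0" for x
    proof -
      have "x - p x \<in> {x. p x = 0}" by (simp add: plin p)
      then show ?thesis using emb'(1) unfolding is_operator_def by blast
    qed
    show "j (p x - p (p x)) = 0" for x by (simp add: p \<open>j 0 = 0\<close>)
    show "p (js y) = 0" for y using emb'(2) by (auto simp: is_operator_def)
    show "js (p' y) = 0" for y
      using p'[of y] Y.ip_eq_0_commute by (intro emb') (auto simp: p'0)
  qed
qed

lemma schur_coupled_if_kernels_match:
  fixes sX :: "'k::real_or_complex \<Rightarrow> 'a::banach \<Rightarrow> 'a" and sY :: "'k \<Rightarrow> 'b::banach \<Rightarrow> 'b"
  assumes HX: "hilbert_space sX ipX" and HY: "hilbert_space sY ipY"
    and U: "is_operator sX sX UNIV UNIV U" "closed (range U)"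
    and V: "is_operator sY sY UNIV UNIV V" "closed (range V)"
    and K: "invertible_operator sX sY (ker U) (ker V) K"
    and L: "invertible_operator sX sY (ker (hilbert_adjoint ipX ipX U)) (ker (hilbert_adjoint ipY ipY V)) L"
  shows "schur_coupled sX sY U V"
proof -
  interpret X: hilbert_space sX ipX by fact
  interpret Y: hilbert_space sY ipY by fact
  have BX: "banach_space sX" and BY: "banach_space sY" by unfold_locales
  have orthX: "X.subspace {x. \<forall>z\<in>ker U. ipX x z = 0} \<and> closed {x. \<forall>z\<in>ker U. ipX x z = 0}"
    by (rule X.orthogonal_complement)
  have orthY: "Y.subspace {x. \<forall>z\<in>ker V. ipY x z = 0} \<and> closed {x. \<forall>z\<in>ker V. ipY x z = 0}"
    by (rule Y.orthogonal_complement)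
  note cmp = hilbert_spaces_comparable[OF HX HY conjunct1[OF orthX] conjunct2[OF orthX]
      conjunct1[OF orthY] conjunct2[OF orthY]]
  have K': "invertible_operator sY sX (ker V) (ker U) (inv_into (ker U) K)"
    using subspace_ker(1)[OF BX BX U(1)]
    by (intro invertible_operator_inverse[OF K]) (auto simp: X.subspace_def)
  have L': "invertible_operator sY sX (ker (hilbert_adjoint ipY ipY V)) (ker (hilbert_adjoint ipX ipX U))
      (inv_into (ker (hilbert_adjoint ipX ipX U)) L)"
    by (intro invertible_operator_inverse[OF L])
      (auto simp: X.ker_hilbert_adjoint[OF U(1)] X.ip_add_right X.ip_scale_right)
  from cmp show ?thesis
    using schur_coupled_if_embedding[OF HX HY U V K L]
      schur_coupled_commute[OF schur_coupled_if_embedding[OF HY HX V U K' L']] by blast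
qed

section \<open>Equivalence after extension from Schur coupling\<close>

text \<open>
  The extension spaces are \<open>Y\<close> for \<open>U\<close> and \<open>X\<close> for \<open>V\<close>. With \<open>T\<close> the coupling matrix,
  \<open>U \<oplus> D = L\<^sub>1 T R\<^sub>1\<close> and \<open>A \<oplus> V = L\<^sub>2 T R\<^sub>2\<close> for triangular invertible factors, so that
  \<open>U \<oplus> I = L\<^sub>1 L\<^sub>2\<^sup>-\<^sup>1 (A \<oplus> V) R\<^sub>2\<^sup>-\<^sup>1 R\<^sub>1 (I \<oplus> D\<^sup>-\<^sup>1)\<close>. Collecting the factors, with the coordinates of
  \<open>A \<oplus> V\<close> swapped and \<open>A\<close> moved into the right factor, gives \<open>E\<close> and \<open>F\<close>.
\<close>

lemma schur_coupled_imp_equivalent_after_extension: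
  fixes sX :: "'k::real_or_complex \<Rightarrow> 'a::banach \<Rightarrow> 'a" and sY :: "'k \<Rightarrow> 'b::banach \<Rightarrow> 'b"
    and sZ :: "'k \<Rightarrow> 'c::banach \<Rightarrow> 'c"
  assumes X: "banach_space sX" and Y: "banach_space sY" and Z: "banach_space sZ"
    and sc: "schur_coupled sX sY U V"
  shows "equivalent_after_extension sX sY (prod_scale sX (prod_scale sY sZ)) U V"
proof -
  interpret X: banach_space sX by fact
  interpret Y: banach_space sY by fact
  interpret Z: banach_space sZ by fact
  define sW where "sW = prod_scale sX (prod_scale sY sZ)"
  interpret W: banach_space sW
    unfolding sW_def by (intro banach_space_prod_scale) fact+
  obtain A B C D where A: "is_operator sX sX UNIV UNIV A" and B: "is_operator sY sX UNIV UNIV B"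
    and C: "is_operator sX sY UNIV UNIV C" and D: "is_operator sY sY UNIV UNIV D"
    and invA: "invertible_operator sX sX UNIV UNIV A" and invD: "invertible_operator sY sY UNIV UNIV D"
    and U: "U = (\<lambda>x. A x - B (inv D (C x)))" and V: "V = (\<lambda>y. D y - C (inv A (B y)))"
    using sc unfolding schur_coupled_def by blast
  define A' where "A' = inv A"
  define D' where "D' = inv D"
  have A': "is_operator sX sX UNIV UNIV A'" and D': "is_operator sY sY UNIV UNIV D'"
    and "bij A" "bij D"
    using invA invD by (auto simp: invertible_operator_def A'_def D'_def)
  have inv: "A (A' x) = x" "A' (A x) = x" "D (D' y) = y" "D' (D y) = y" for x y
    using \<open>bij A\<close> \<open>bij D\<close> by (simp_all add: A'_def D'_def bij_is_inj bij_is_surj surj_f_inv_f)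
  have U: "U x = A x - B (D' (C x))" and V: "V y = D y - C (A' (B y))" for x y
    by (simp_all add: U V A'_def D'_def)
  have add: "f (x + y) = f x + f y" if "is_operator s t UNIV UNIV f"
    for f :: "'u::banach \<Rightarrow> 'v::banach" and s :: "'k \<Rightarrow> 'u \<Rightarrow> 'u" and t :: "'k \<Rightarrow> 'v \<Rightarrow> 'v" and x y
    using that by (auto simp: is_operator_def)
  note ops = A B C D A' D'
  note lin = ops[THEN add] ops[THEN is_operator_zero_diff(1)] ops[THEN is_operator_zero_diff(2)]
  define F where "F z = (D' (snd z - C (fst z)), A (fst z) + B (D' (snd z - C (fst z))))" for z
  define F' where "F' z = (A' (snd z - B (fst z)), D (fst z) + C (A' (snd z - B (fst z))))" for z
  define E where "E z = (snd z - B (D' (fst z + C (A' (snd z)))), fst z + C (A' (snd z)))" for z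
  define E' where "E' z = (snd z - C (A' (fst z + B (D' (snd z)))), fst z + B (D' (snd z)))" for z
  note XY = banach_space_prod_scale[OF X Y] and YX = banach_space_prod_scale[OF Y X]
  note intros = is_operator_Pair is_operator_diff is_operator_add X Y XY YX is_operator_fst
    is_operator_snd is_operator_comp[OF _ A] is_operator_comp[OF _ B] is_operator_comp[OF _ C]
    is_operator_comp[OF _ D] is_operator_comp[OF _ A'] is_operator_comp[OF _ D']
  have E: "is_operator (prod_scale sY sX) (prod_scale sX sY) UNIV UNIV E"
    unfolding E_def[abs_def] by (intro intros)
  have E': "is_operator (prod_scale sX sY) (prod_scale sY sX) UNIV UNIV E'"
    unfolding E'_def[abs_def] by (intro intros)
  have F: "is_operator (prod_scale sX sY) (prod_scale sY sX) UNIV UNIV F"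
    unfolding F_def[abs_def] by (intro intros)
  have F': "is_operator (prod_scale sY sX) (prod_scale sX sY) UNIV UNIV F'"
    unfolding F'_def[abs_def] by (intro intros)
  have invE: "invertible_operator (prod_scale sY sX) (prod_scale sX sY) UNIV UNIV E"
    by (rule invertible_operatorI[OF E E']) (auto simp: E_def E'_def lin inv)
  have invF: "invertible_operator (prod_scale sX sY) (prod_scale sY sX) UNIV UNIV F"
    by (rule invertible_operatorI[OF F F']) (auto simp: F_def F'_def lin inv)
  have UV: "map_prod U id z = E (map_prod V id (F z))" for z
    by (cases z) (simp add: E_def F_def U V lin inv)
  define jX :: "'a \<Rightarrow> 'a \<times> 'b \<times> 'c" where "jX x = (x, 0, 0)" for x
  define jY :: "'b \<Rightarrow> 'a \<times> 'b \<times> 'c" where "jY y = (0, y, 0)" for y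
  define rX :: "'a \<times> 'b \<times> 'c \<Rightarrow> 'a" where "rX w = fst w" for w
  define rY :: "'a \<times> 'b \<times> 'c \<Rightarrow> 'b" where "rY w = fst (snd w)" for w
  have jX: "jX (x + x') = jX x + jX x'" "jX (sX c x) = sW c (jX x)" "norm (jX x) = norm x"
    "rX (jX x) = x" for x x' c
    by (simp_all add: jX_def rX_def sW_def prod_scale_def norm_Pair)
  have jY: "jY (x + x') = jY x + jY x'" "jY (sY c x) = sW c (jY x)" "norm (jY x) = norm x"
    "rY (jY x) = x" for x x' c
    by (simp_all add: jY_def rY_def sW_def prod_scale_def norm_Pair)
  have rangeX: "range jX = UNIV \<times> {0} \<times> {0}" and rangeY: "range jY = {0} \<times> UNIV \<times> {0}"
    by (auto simp: jX_def jY_def)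
  have sub: "W.subspace (range jY)" "W.subspace (range jX)"
    unfolding W.subspace_def by (auto simp: rangeX rangeY zero_prod_def sW_def prod_scale_def)
  have cl: "closed (range jY)" "closed (range jX)"
    by (auto simp: rangeX rangeY intro!: closed_Times)
  have E2: "invertible_operator (prod_scale sY sW) (prod_scale sX sW)
      (UNIV \<times> range jX) (UNIV \<times> range jY) (map_prod id jY \<circ> E \<circ> map_prod id rX)"
    by (rule transport_invertible[OF invE]) (fact jX jY)+
  have F2: "invertible_operator (prod_scale sX sW) (prod_scale sY sW)
      (UNIV \<times> range jY) (UNIV \<times> range jX) (map_prod id jX \<circ> F \<circ> map_prod id rY)"
    by (rule transport_invertible[OF invF]) (fact jX jY)+
  have "map_prod U id p = (map_prod id jY \<circ> E \<circ> map_prod id rX)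
      (map_prod V id ((map_prod id jX \<circ> F \<circ> map_prod id rY) p))"
    if p: "p \<in> UNIV \<times> range jY" for p
  proof -
    obtain x y where p: "p = (x, jY y)" using p by auto
    have "map_prod id rX (map_prod V id (map_prod id jX q)) = map_prod V id q" for q
      by (cases q) (simp add: jX)
    then show ?thesis using UV[of "(x, y)"] by (simp add: p jY flip: UV)
  qed
  with sub cl E2 F2 have "equivalent_after_extension sX sY sW U V"
    unfolding equivalent_after_extension_def by blast
  then show ?thesis by (simp only: sW_def)
qed

section \<open>Kernels and cokernels under equivalence after extension\<close>

text \<open>
  If \<open>F (x, 0) = (y, w)\<close> with \<open>U x = 0\<close>, then \<open>E (V y, w) = 0\<close>, and injectivity of \<open>E\<close> forces \<open>V y = 0\<close>
  and \<open>w = 0\<close>.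
\<close>

lemma equivalence_maps_kernel:
  fixes sX :: "'k::real_or_complex \<Rightarrow> 'a::banach \<Rightarrow> 'a" and sY :: "'k \<Rightarrow> 'b::banach \<Rightarrow> 'b"
    and sW :: "'k \<Rightarrow> 'w::banach \<Rightarrow> 'w"
  assumes V: "is_operator sY sY UNIV UNIV V" and "0 \<in> X\<^sub>0" "0 \<in> Y\<^sub>0"
    and E: "is_operator (prod_scale sY sW) (prod_scale sX sW) (UNIV \<times> Y\<^sub>0) (UNIV \<times> X\<^sub>0) E"
    and inj: "inj_on E (UNIV \<times> Y\<^sub>0)"
    and F: "is_operator (prod_scale sX sW) (prod_scale sY sW) (UNIV \<times> X\<^sub>0) (UNIV \<times> Y\<^sub>0) F"
    and eq: "\<forall>z\<in>UNIV \<times> X\<^sub>0. map_prod U id z = E (map_prod V id (F z))"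
    and x: "x \<in> ker U"
  shows "\<exists>y\<in>ker V. F (x, 0) = (y, 0)"
proof -
  obtain y w where yw: "F (x, 0) = (y, w)" by force
  have "F (x, 0) \<in> UNIV \<times> Y\<^sub>0"
    using F \<open>0 \<in> X\<^sub>0\<close> by (auto simp: is_operator_def)
  then have w: "w \<in> Y\<^sub>0" by (simp add: yw)
  have "E (0 + 0) = E 0 + E 0"
    using E \<open>0 \<in> Y\<^sub>0\<close> unfolding is_operator_def zero_prod_def by blast
  then have "E (0, 0) = (0, 0)" by (simp add: zero_prod_def)
  moreover have "E (V y, w) = (0, 0)"
    using bspec[OF eq, of "(x, 0)"] x \<open>0 \<in> X\<^sub>0\<close> by (simp add: yw ker_def)
  ultimately have "(V y, w) = (0, 0)"
    using inj w \<open>0 \<in> Y\<^sub>0\<close> by (auto dest!: inj_onD[where x = "(V y, w)" and y = "(0, 0)"])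
  then show ?thesis using yw by (auto simp: ker_def)
qed

text \<open>
  The maps \<open>y \<mapsto> P (fst (E (y, 0)))\<close> and \<open>x \<mapsto> P' (fst (E' (x, 0)))\<close> represent the isomorphisms that \<open>E\<close>
  and its inverse induce between \<open>Y / ran V\<close> and \<open>X / ran U\<close>. Going forth and back returns \<open>y\<close> because
  the part of \<open>E (y, 0)\<close> discarded by \<open>P\<close> lies in the range of \<open>U \<oplus> I\<close>, hence is the image under \<open>E\<close>
  of an element of the range of \<open>V \<oplus> I\<close>, whose first component is killed by \<open>P'\<close>.
\<close>

lemma equivalence_maps_cokernel:
  fixes sX :: "'k::real_or_complex \<Rightarrow> 'a::banach \<Rightarrow> 'a" and sY :: "'k \<Rightarrow> 'b::banach \<Rightarrow> 'b"
    and sW :: "'k \<Rightarrow> 'w::banach \<Rightarrow> 'w"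
  assumes W: "banach_space sW" "module.subspace sW Y\<^sub>0" and "0 \<in> X\<^sub>0"
    and spX: "splitting sX U N M p P S" and spY: "splitting sY V N' M' p' P' S'"
    and E: "is_operator (prod_scale sY sW) (prod_scale sX sW) (UNIV \<times> Y\<^sub>0) (UNIV \<times> X\<^sub>0) E"
    and E': "\<forall>z\<in>UNIV \<times> Y\<^sub>0. E' (E z) = z"
    and F: "is_operator (prod_scale sX sW) (prod_scale sY sW) (UNIV \<times> X\<^sub>0) (UNIV \<times> Y\<^sub>0) F"
    and eq: "\<forall>z\<in>UNIV \<times> X\<^sub>0. map_prod U id z = E (map_prod V id (F z))"
    and y: "y \<in> M'"
  shows "P' (fst (E' (P (fst (E (y, 0))), 0))) = y"
proof -
  interpret W: banach_space sW by fact
  obtain x w where xw: "E (y, 0) = (x, w)" by force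
  have Y0: "0 \<in> Y\<^sub>0" using W(2) by (rule W.subspace_0)
  have "E (y, 0) \<in> UNIV \<times> X\<^sub>0"
    using E Y0 by (auto simp: is_operator_def)
  then have w: "w \<in> X\<^sub>0" by (simp add: xw)
  obtain a b where ab: "F (S x, w) = (a, b)" by force
  have "F (S x, w) \<in> UNIV \<times> Y\<^sub>0"
    using F w by (auto simp: is_operator_def)
  then have b: "b \<in> Y\<^sub>0" by (simp add: ab)
  have nb: "- b \<in> Y\<^sub>0" using W.subspace_neg[OF W(2) b] .
  have Eab: "E (V a, b) = (x - P x, w)"
    using bspec[OF eq, of "(S x, w)"] w spX by (simp add: ab splitting_def)
  have "E ((y - V a, - b) + (V a, b)) = E (y - V a, - b) + E (V a, b)"
    using E b nb unfolding is_operator_def by blast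
  then have "E (y - V a, - b) = (P x, 0)"
    by (cases "E (y - V a, - b)") (auto simp: Eab xw)
  then have "E' (P x, 0) = (y - V a, - b)"
    using bspec[OF E', of "(y - V a, - b)"] nb by simp
  moreover have "P' (y - V a) = P' y - P' (V a)"
    using spY by (intro is_operator_zero_diff[of sY sY])
      (auto simp: splitting_def intro: is_operator_codomain)
  ultimately show ?thesis using spY y by (simp add: xw splitting_def)
qed

text \<open>
  The inverses of \<open>E\<close> and \<open>F\<close> express \<open>V \<oplus> I\<close> through \<open>U \<oplus> I\<close>, so the statements about kernels and
  cokernels apply in both directions and provide the inverse maps.
\<close>

lemma kernels_match_if_equivalent_after_extension:
  fixes sX :: "'k::real_or_complex \<Rightarrow> 'a::banach \<Rightarrow> 'a" and sY :: "'k \<Rightarrow> 'b::banach \<Rightarrow> 'b"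
    and sW :: "'k \<Rightarrow> 'w::banach \<Rightarrow> 'w"
  assumes HX: "hilbert_space sX ipX" and HY: "hilbert_space sY ipY" and W: "banach_space sW"
    and U: "is_operator sX sX UNIV UNIV U" "closed (range U)"
    and V: "is_operator sY sY UNIV UNIV V" "closed (range V)"
    and eae: "equivalent_after_extension sX sY sW U V"
  shows "\<exists>K L. invertible_operator sX sY (ker U) (ker V) K \<and>
    invertible_operator sX sY (ker (hilbert_adjoint ipX ipX U)) (ker (hilbert_adjoint ipY ipY V)) L"
proof -
  interpret X: hilbert_space sX ipX by fact
  interpret Y: hilbert_space sY ipY by fact
  interpret W: banach_space sW by fact
  have BX: "banach_space sX" and BY: "banach_space sY" by unfold_locales
  obtain X\<^sub>0 Y\<^sub>0 E F where X0: "W.subspace X\<^sub>0" and Y0: "W.subspace Y\<^sub>0"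
    and E: "invertible_operator (prod_scale sY sW) (prod_scale sX sW) (UNIV \<times> Y\<^sub>0) (UNIV \<times> X\<^sub>0) E"
    and F: "invertible_operator (prod_scale sX sW) (prod_scale sY sW) (UNIV \<times> X\<^sub>0) (UNIV \<times> Y\<^sub>0) F"
    and eq: "\<forall>z\<in>UNIV \<times> X\<^sub>0. map_prod U id z = E (map_prod V id (F z))"
    using eae unfolding equivalent_after_extension_def by blast
  have z: "0 \<in> X\<^sub>0" "0 \<in> Y\<^sub>0" using X0 Y0 W.subspace_0 by auto
  define E' where "E' = inv_into (UNIV \<times> Y\<^sub>0) E"
  define F' where "F' = inv_into (UNIV \<times> X\<^sub>0) F"
  have opE: "is_operator (prod_scale sY sW) (prod_scale sX sW) (UNIV \<times> Y\<^sub>0) (UNIV \<times> X\<^sub>0) E"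
    and opF: "is_operator (prod_scale sX sW) (prod_scale sY sW) (UNIV \<times> X\<^sub>0) (UNIV \<times> Y\<^sub>0) F"
    and opE': "is_operator (prod_scale sX sW) (prod_scale sY sW) (UNIV \<times> X\<^sub>0) (UNIV \<times> Y\<^sub>0) E'"
    and opF': "is_operator (prod_scale sY sW) (prod_scale sX sW) (UNIV \<times> Y\<^sub>0) (UNIV \<times> X\<^sub>0) F'"
    and bij: "bij_betw E (UNIV \<times> Y\<^sub>0) (UNIV \<times> X\<^sub>0)" "bij_betw F (UNIV \<times> X\<^sub>0) (UNIV \<times> Y\<^sub>0)"
    using E F by (auto simp: invertible_operator_def E'_def F'_def)
  have EE': "\<forall>z\<in>UNIV \<times> X\<^sub>0. E (E' z) = z" and FF': "\<forall>z\<in>UNIV \<times> Y\<^sub>0. F (F' z) = z"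
    and E'E: "\<forall>z\<in>UNIV \<times> Y\<^sub>0. E' (E z) = z" and F'F: "\<forall>z\<in>UNIV \<times> X\<^sub>0. F' (F z) = z"
    unfolding E'_def F'_def using bij
    by (blast intro: bij_betw_inv_into_left bij_betw_inv_into_right)+
  have injE: "inj_on E (UNIV \<times> Y\<^sub>0)" using bij by (simp add: bij_betw_def)
  have injE': "inj_on E' (UNIV \<times> X\<^sub>0)" using EE' by (intro inj_on_inverseI[where g = E]) blast
  have eq': "\<forall>z\<in>UNIV \<times> Y\<^sub>0. map_prod V id z = E' (map_prod U id (F' z))"
  proof
    fix z :: "'b \<times> 'w" assume that: "z \<in> UNIV \<times> Y\<^sub>0"
    have "F' z \<in> UNIV \<times> X\<^sub>0" using opF' that unfolding is_operator_def by blast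
    then have "map_prod U id (F' z) = E (map_prod V id z)"
      using eq FF' that by (metis (no_types))
    moreover have "map_prod V id z \<in> UNIV \<times> Y\<^sub>0" using that by auto
    ultimately show "map_prod V id z = E' (map_prod U id (F' z))" using E'E by (metis (no_types))
  qed
  note kerF = equivalence_maps_kernel[OF V(1) z opE injE opF eq]
  note kerF' = equivalence_maps_kernel[OF U(1) z(2,1) opE' injE' opF' eq']
  have emb: "is_operator s (prod_scale s sW) T (UNIV \<times> T') (\<lambda>x. (x, 0))"
    if "0 \<in> T'" for s :: "'k \<Rightarrow> 'u::real_normed_vector \<Rightarrow> 'u" and T T'
    using that by (auto simp: is_operator_def prod_scale_def norm_Pair intro!: exI[of _ 1])
  have "is_operator sX sY (ker U) UNIV (\<lambda>x. fst (F (x, 0)))"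
    by (rule is_operator_comp[OF is_operator_comp[OF emb[OF z(1)] opF] is_operator_fst])
  then have K: "is_operator sX sY (ker U) (ker V) (\<lambda>x. fst (F (x, 0)))"
    by (rule is_operator_codomain) (use kerF in force)
  have "is_operator sY sX (ker V) UNIV (\<lambda>y. fst (F' (y, 0)))"
    by (rule is_operator_comp[OF is_operator_comp[OF emb[OF z(2)] opF'] is_operator_fst])
  then have K': "is_operator sY sX (ker V) (ker U) (\<lambda>y. fst (F' (y, 0)))"
    by (rule is_operator_codomain) (use kerF' in force)
  have invK: "invertible_operator sX sY (ker U) (ker V) (\<lambda>x. fst (F (x, 0)))"
  proof (rule invertible_operatorI[OF K K'])
    show "fst (F' (fst (F (x, 0)), 0)) = x" if "x \<in> ker U" for x
      using kerF[OF that] bspec[OF F'F, of "(x, 0)"] z by auto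
    show "fst (F (fst (F' (y, 0)), 0)) = y" if "y \<in> ker V" for y
      using kerF'[OF that] bspec[OF FF', of "(y, 0)"] z by auto
  qed (use subspace_ker(1)[OF BY BY V(1)] in \<open>auto simp: Y.subspace_def\<close>)
  obtain p P S where spX: "splitting sX U (ker U) (ker (hilbert_adjoint ipX ipX U)) p P S"
    using closed_range_splitting[OF HX U] by metis
  obtain p' P' S' where spY: "splitting sY V (ker V) (ker (hilbert_adjoint ipY ipY V)) p' P' S'"
    using closed_range_splitting[OF HY V] by metis
  have P: "is_operator sX sX UNIV (ker (hilbert_adjoint ipX ipX U)) P"
    and P': "is_operator sY sY UNIV (ker (hilbert_adjoint ipY ipY V)) P'"
    using spX spY by (auto simp: splitting_def)
  have L: "is_operator sX sY (ker (hilbert_adjoint ipX ipX U)) (ker (hilbert_adjoint ipY ipY V))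
      (\<lambda>x. P' (fst (E' (x, 0))))"
    by (rule is_operator_comp[OF is_operator_comp[OF is_operator_comp[OF emb[OF z(1)] opE'] is_operator_fst] P'])
  have L': "is_operator sY sX (ker (hilbert_adjoint ipY ipY V)) (ker (hilbert_adjoint ipX ipX U))
      (\<lambda>y. P (fst (E (y, 0))))"
    by (rule is_operator_comp[OF is_operator_comp[OF is_operator_comp[OF emb[OF z(2)] opE] is_operator_fst] P])
  have "invertible_operator sX sY (ker (hilbert_adjoint ipX ipX U)) (ker (hilbert_adjoint ipY ipY V))
      (\<lambda>x. P' (fst (E' (x, 0))))"
    by (rule invertible_operatorI[OF L L']
        equivalence_maps_cokernel[OF W Y0 z(1) spX spY opE E'E opF eq]
        equivalence_maps_cokernel[OF W X0 z(2) spY spX opE' EE' opF' eq'] | assumption)+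
      (auto simp: Y.ker_hilbert_adjoint[OF V(1)] Y.ip_add_right Y.ip_scale_right)
  with invK show ?thesis by blast
qed

section \<open>Equivalence of the three conditions\<close>

theorem theorem1p3:
  fixes sX :: "'k::real_or_complex \<Rightarrow> 'a::banach \<Rightarrow> 'a" and ipX :: "'a \<Rightarrow> 'a \<Rightarrow> 'k"
    and sY :: "'k \<Rightarrow> 'b::banach \<Rightarrow> 'b" and ipY :: "'b \<Rightarrow> 'b \<Rightarrow> 'k"
    and sZ :: "'k \<Rightarrow> 'c::banach \<Rightarrow> 'c"
    and U :: "'a \<Rightarrow> 'a" and V :: "'b \<Rightarrow> 'b"
  assumes "hilbert_space sX ipX" and "hilbert_space sY ipY" and "banach_space sZ"
    and "is_operator sX sX UNIV UNIV U" and "closed (range U)"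
    and "is_operator sY sY UNIV UNIV V" and "closed (range V)"
  shows "(schur_coupled sX sY U V \<longleftrightarrow>
          equivalent_after_extension sX sY (prod_scale sX (prod_scale sY sZ)) U V) \<and>
         (equivalent_after_extension sX sY (prod_scale sX (prod_scale sY sZ)) U V \<longleftrightarrow>
          (\<exists>K K_star.
             invertible_operator sX sY (ker U) (ker V) K \<and>
             invertible_operator sX sY
               (ker (hilbert_adjoint ipX ipX U)) (ker (hilbert_adjoint ipY ipY V)) K_star))"
proof -
  have X: "banach_space sX" and Y: "banach_space sY"
    using assms(1,2) by (simp_all add: hilbert_space_def)
  have W: "banach_space (prod_scale sX (prod_scale sY sZ))"
    by (intro banach_space_prod_scale X Y assms)
  show ?thesis
    using schur_coupled_imp_equivalent_after_extension[OF X Y assms(3), of U V]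
      kernels_match_if_equivalent_after_extension[OF assms(1,2) W assms(4-7)]
      schur_coupled_if_kernels_match[OF assms(1,2,4-7)]
    by blast
qed

end
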